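(* Let $\alpha\in\mathbb{C}$ and $\beta\in\mathbb{C}\setminus\{0\}$, and let $P=M_{\alpha,\beta}=(\xi-\alpha,\,K-\beta)$ be the corresponding maximal ideal of $R$. (1) If $\alpha=\frac{\beta^{m}-\beta^{-m}}{q-q^{-1}}$ and $\beta^{m}=\pm q^{mn}$ for some integer $n\geq 0$, then $\theta^{n}(\xi)\in M_{\alpha,\beta}$ and $\theta^{-1}(\xi)\in M_{\alpha,\beta}$, and $U/P_{1,n+1}$ is a finite dimensional irreducible representation of $U$. (2) If $\alpha=\frac{\beta^{m}-\beta^{-m}}{q-q^{-1}}$ and $\beta^{m}\neq\pm q^{mn}$ for all integers $n\geq 0$, then $U/P_{1,\infty}$ is an infinite dimensional irreducible representation of $U$. (3) If $\alpha=0$ and $\frac{1}{q-q^{-1}}\left(\frac{1-q^{2nm}}{1-q^{2m}}\beta^{m}-\frac{1-q^{-2nm}}{1-q^{-2m}}\beta^{-m}\right)\neq 0$ for every integer $n\geq 1$, then $U/P_{\infty,1}$ is an infinite dimensional irreducible representation of $U$.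
   Context: Let $q\in\mathbb{C}$ be nonzero and not a root of unity, and let $m\geq 1$ be an integer. Put $f_m(K)=\frac{K^{m}-K^{-m}}{q-q^{-1}}$. $U=U_q(f_m(K))$ is the associative unital $\mathbb{C}$-algebra generated by $E,F,K^{\pm1}$ with relations $KE=q^{2}EK$, $KF=q^{-2}FK$, $KK^{-1}=K^{-1}K=1$, $EF-FE=f_m(K)$. Let $\xi=EF$ and let $R$ be the (commutative) subalgebra of $U$ generated by $\xi,K^{\pm1}$. Let $\theta$ be the algebra automorphism of $R$ given by $\theta(K^{\pm1})=q^{\mp2}K^{\pm1}$ and $\theta(\xi)=\xi+f_m(\theta(K))$, where $f_m(\theta(K))=f_m(q^{-2}K)$. For an ideal $P$ of $R$ define the left ideals of $U$: $P_{1,n+1}=UP+UE+UF^{n+1}$ for $n\geq 0$, $P_{1,\infty}=UP+UE$, $P_{\infty,1}=UP+UF$. Representations are left $U$-modules. *)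

theory Defs
  imports
    "HOL-Library.Poly_Mapping"
    "HOL-Algebra.QuotRing"
    "HOL-Algebra.Ideal_Product"
    "HOL-Algebra.Generated_Rings"
    "HOL-Algebra.Module"
    "HOL-Algebra.Algebraic_Closure_Type"
begin

section \<open>The free algebra on four generators\<close>

datatype gen = GenE | GenF | GenK | GenKinv

text \<open>
  Words under concatenation form a monoid, written additively here because
  \<^typ>\<open>'a \<Rightarrow>\<^sub>0 'b\<close> is a monoid algebra (with convolution product) over an additive monoid of
  exponents. Hence \<^typ>\<open>gen list \<Rightarrow>\<^sub>0 complex\<close> is the free unital algebra
  on the four letters.
\<close>

instantiation list :: (type) monoid_add
begin
definition zero_list :: "'a list" where "zero_list = []"
definition plus_list :: "'a list \<Rightarrow> 'a list \<Rightarrow> 'a list" where "plus_list u v = u @ v"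
instance by standard (simp_all add: zero_list_def plus_list_def)
end

type_synonym free_elem = "gen list \<Rightarrow>\<^sub>0 complex"

abbreviation free_alg :: "free_elem ring" where
  "free_alg \<equiv> ring_of_type_algebra"

definition letter :: "gen \<Rightarrow> free_elem" where
  "letter g = Poly_Mapping.single [g] 1"

definition free_scalar :: "complex \<Rightarrow> free_elem" where
  "free_scalar c = Poly_Mapping.single [] c"


section \<open>The algebra \<open>U\<^sub>q(f\<^sub>m(K))\<close>\<close>

text \<open>
  The Laurent polynomial \<open>(x\<^sup>m - x\<^sup>-\<^sup>m) / (q - q\<^sup>-\<^sup>1)\<close> evaluated in a ring \<open>A\<close> with structure
  map \<open>s\<close> from the complex numbers. The element \<open>y\<close> stands for the inverse of \<open>x\<close>; it is a
  separate argument so that the formula also makes sense in the free algebra, where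
  the letter for \<open>K\<close> is not invertible.
\<close>
definition f_eval ::
  "('a, 'r) ring_scheme \<Rightarrow> (complex \<Rightarrow> 'a) \<Rightarrow> complex \<Rightarrow> nat \<Rightarrow> 'a \<Rightarrow> 'a \<Rightarrow> 'a" where
  "f_eval A s q m x y =
     s (1 / (q - inverse q)) \<otimes>\<^bsub>A\<^esub> (x [^]\<^bsub>A\<^esub> m \<ominus>\<^bsub>A\<^esub> y [^]\<^bsub>A\<^esub> m)"

definition U_relators :: "complex \<Rightarrow> nat \<Rightarrow> free_elem set" where
  "U_relators q m =
     (let E = letter GenE; F = letter GenF; K = letter GenK; K' = letter GenKinv in
      {K * E - free_scalar (q ^ 2) * E * K,
       K * F - free_scalar (inverse q ^ 2) * F * K,
       K * K' - 1,
       K' * K - 1,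
       E * F - F * E - f_eval free_alg free_scalar q m K K'})"

definition U_ideal :: "complex \<Rightarrow> nat \<Rightarrow> free_elem set" where
  "U_ideal q m = Idl\<^bsub>free_alg\<^esub> (U_relators q m)"

definition U_alg :: "complex \<Rightarrow> nat \<Rightarrow> free_elem set ring" where
  "U_alg q m = free_alg Quot U_ideal q m"

definition U_class :: "complex \<Rightarrow> nat \<Rightarrow> free_elem \<Rightarrow> free_elem set" where
  "U_class q m a = U_ideal q m +>\<^bsub>free_alg\<^esub> a"

definition E_gen :: "complex \<Rightarrow> nat \<Rightarrow> free_elem set" where
  "E_gen q m = U_class q m (letter GenE)"

definition F_gen :: "complex \<Rightarrow> nat \<Rightarrow> free_elem set" where
  "F_gen q m = U_class q m (letter GenF)"

definition K_gen :: "complex \<Rightarrow> nat \<Rightarrow> free_elem set" where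
  "K_gen q m = U_class q m (letter GenK)"

definition Kinv_gen :: "complex \<Rightarrow> nat \<Rightarrow> free_elem set" where
  "Kinv_gen q m = U_class q m (letter GenKinv)"

text \<open>
  The structure map of the complex algebra \<open>U\<close>: scalar multiplication by \<open>c\<close> is
  multiplication by the central element \<open>U_scalar q m c\<close>.
\<close>
definition U_scalar :: "complex \<Rightarrow> nat \<Rightarrow> complex \<Rightarrow> free_elem set" where
  "U_scalar q m c = U_class q m (free_scalar c)"


section \<open>The subalgebra \<open>R\<close>, its automorphism and its ideals\<close>

definition xi :: "complex \<Rightarrow> nat \<Rightarrow> free_elem set" where
  "xi q m = E_gen q m \<otimes>\<^bsub>U_alg q m\<^esub> F_gen q m"

text \<open>Including all scalars among the ring generators makes this the generated subalgebra.\<close>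
definition R_alg :: "complex \<Rightarrow> nat \<Rightarrow> free_elem set ring" where
  "R_alg q m = (U_alg q m)
     \<lparr>carrier := generate_ring (U_alg q m)
        (range (U_scalar q m) \<union> {xi q m, K_gen q m, Kinv_gen q m})\<rparr>"

definition is_theta ::
  "complex \<Rightarrow> nat \<Rightarrow> (free_elem set \<Rightarrow> free_elem set) \<Rightarrow> bool" where
  "is_theta q m t \<longleftrightarrow>
     t \<in> ring_iso (R_alg q m) (R_alg q m) \<and>
     (\<forall>c. t (U_scalar q m c) = U_scalar q m c) \<and>
     t (K_gen q m) = U_scalar q m (inverse q ^ 2) \<otimes>\<^bsub>R_alg q m\<^esub> K_gen q m \<and>
     t (Kinv_gen q m) = U_scalar q m (q ^ 2) \<otimes>\<^bsub>R_alg q m\<^esub> Kinv_gen q m \<and>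
     t (xi q m) = xi q m \<oplus>\<^bsub>R_alg q m\<^esub>
       f_eval (R_alg q m) (U_scalar q m) q m (t (K_gen q m)) (t (Kinv_gen q m))"

text \<open>Extensionality only fixes the irrelevant values outside \<open>R\<close>, for uniqueness.\<close>
definition theta :: "complex \<Rightarrow> nat \<Rightarrow> free_elem set \<Rightarrow> free_elem set" where
  "theta q m = (THE t. t \<in> extensional (carrier (R_alg q m)) \<and> is_theta q m t)"

definition theta_inv :: "complex \<Rightarrow> nat \<Rightarrow> free_elem set \<Rightarrow> free_elem set" where
  "theta_inv q m = inv_into (carrier (R_alg q m)) (theta q m)"

definition M_ideal :: "complex \<Rightarrow> nat \<Rightarrow> complex \<Rightarrow> complex \<Rightarrow> free_elem set set" where
  "M_ideal q m \<alpha> \<beta> = Idl\<^bsub>R_alg q m\<^esub>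
     {xi q m \<ominus>\<^bsub>R_alg q m\<^esub> U_scalar q m \<alpha>,
      K_gen q m \<ominus>\<^bsub>R_alg q m\<^esub> U_scalar q m \<beta>}"

text \<open>
  \<open>ideal_prod U (carrier U) P\<close> is the set \<open>UP\<close> of finite sums of products, and
  \<open>carrier U #> x\<close> is the set \<open>Ux\<close> of left multiples of \<open>x\<close>.
  The last argument of \<open>P_1_fin\<close> is the exponent of \<open>F\<close>.
\<close>
definition P_1_fin ::
  "complex \<Rightarrow> nat \<Rightarrow> free_elem set set \<Rightarrow> nat \<Rightarrow> free_elem set set" where
  "P_1_fin q m P k = (let U = U_alg q m in
     (ideal_prod U (carrier U) P <+>\<^bsub>U\<^esub> (carrier U #>\<^bsub>U\<^esub> E_gen q m))
       <+>\<^bsub>U\<^esub> (carrier U #>\<^bsub>U\<^esub> (F_gen q m [^]\<^bsub>U\<^esub> k)))"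

definition P_1_inf :: "complex \<Rightarrow> nat \<Rightarrow> free_elem set set \<Rightarrow> free_elem set set" where
  "P_1_inf q m P = (let U = U_alg q m in
     ideal_prod U (carrier U) P <+>\<^bsub>U\<^esub> (carrier U #>\<^bsub>U\<^esub> E_gen q m))"

definition P_inf_1 :: "complex \<Rightarrow> nat \<Rightarrow> free_elem set set \<Rightarrow> free_elem set set" where
  "P_inf_1 q m P = (let U = U_alg q m in
     ideal_prod U (carrier U) P <+>\<^bsub>U\<^esub> (carrier U #>\<^bsub>U\<^esub> F_gen q m))"


section \<open>Left modules over a noncommutative ring\<close>

text \<open>The locale \<^locale>\<open>module\<close> requires a commutative base ring; this one does not.\<close>
locale left_module = R?: ring R + M?: abelian_group M
  for R :: "('a, 'r) ring_scheme" (structure)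
  and M :: "('a, 'b, 's) module_scheme" (structure) +
  assumes smult_closed:
      "\<lbrakk>a \<in> carrier R; x \<in> carrier M\<rbrakk> \<Longrightarrow> a \<odot>\<^bsub>M\<^esub> x \<in> carrier M"
    and smult_l_distr:
      "\<lbrakk>a \<in> carrier R; b \<in> carrier R; x \<in> carrier M\<rbrakk> \<Longrightarrow>
       (a \<oplus> b) \<odot>\<^bsub>M\<^esub> x = a \<odot>\<^bsub>M\<^esub> x \<oplus>\<^bsub>M\<^esub> b \<odot>\<^bsub>M\<^esub> x"
    and smult_r_distr:
      "\<lbrakk>a \<in> carrier R; x \<in> carrier M; y \<in> carrier M\<rbrakk> \<Longrightarrow>
       a \<odot>\<^bsub>M\<^esub> (x \<oplus>\<^bsub>M\<^esub> y) = a \<odot>\<^bsub>M\<^esub> x \<oplus>\<^bsub>M\<^esub> a \<odot>\<^bsub>M\<^esub> y"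
    and smult_assoc1:
      "\<lbrakk>a \<in> carrier R; b \<in> carrier R; x \<in> carrier M\<rbrakk> \<Longrightarrow>
       (a \<otimes> b) \<odot>\<^bsub>M\<^esub> x = a \<odot>\<^bsub>M\<^esub> (b \<odot>\<^bsub>M\<^esub> x)"
    and smult_one:
      "x \<in> carrier M \<Longrightarrow> \<one> \<odot>\<^bsub>M\<^esub> x = x"

text \<open>
  The left module \<open>A/L\<close>. The fields \<open>mult\<close> and \<open>one\<close> belong to the library's module
  record but play no role in module theory.
\<close>
definition quot_module :: "('a, 'r) ring_scheme \<Rightarrow> 'a set \<Rightarrow> ('a, 'a set) module" where
  "quot_module A L =
     \<lparr>carrier = a_rcosets\<^bsub>A\<^esub> L, monoid.mult = undefined, one = undefined,
      zero = L, add = set_add A,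
      module.smult = (\<lambda>a C. \<Union>x\<in>C. L +>\<^bsub>A\<^esub> (a \<otimes>\<^bsub>A\<^esub> x))\<rparr>"

definition irreducible_module :: "('a, 'r) ring_scheme \<Rightarrow> ('a, 'b, 's) module_scheme \<Rightarrow> bool" where
  "irreducible_module A M \<longleftrightarrow>
     left_module A M \<and> carrier M \<noteq> {\<zero>\<^bsub>M\<^esub>} \<and>
     (\<forall>N. submodule N A M \<longrightarrow> N = {\<zero>\<^bsub>M\<^esub>} \<or> N = carrier M)"

text \<open>
  Finite dimensionality over the complex numbers of a module over an algebra with
  structure map \<open>s\<close>, that is, existence of a finite spanning set.
\<close>
definition finite_dim_module :: "(complex \<Rightarrow> 'a) \<Rightarrow> ('a, 'b, 's) module_scheme \<Rightarrow> bool" where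
  "finite_dim_module s M \<longleftrightarrow>
     (\<exists>B. finite B \<and> B \<subseteq> carrier M \<and>
        (\<forall>x\<in>carrier M. \<exists>c. x = (\<Oplus>\<^bsub>M\<^esub>b\<in>B. s (c b) \<odot>\<^bsub>M\<^esub> b)))"

end

theory Submission
  imports Defs "HOL-Computational_Algebra.Polynomial"
begin

text \<open>
  Write \<open>f(x)\<close> for \<open>(x\<^sup>m - x\<^sup>-\<^sup>m) / (q - q\<^sup>-\<^sup>1)\<close>. In each of the three cases the module is \<open>U/L\<close>, where the
  generator \<open>v\<close>, the class of \<open>1\<close>, satisfies \<open>Kv = \<beta>v\<close> and is annihilated by one of the letters
  \<open>E\<close>, \<open>F\<close>. Call this letter \<open>Y\<close> and the other one \<open>X\<close>. The defining relations give
  \<open>K X\<^sup>k v = p\<^sup>k \<beta> X\<^sup>k v\<close> and \<open>Y X\<^sup>k\<^sup>+\<^sup>1 v = \<tau>\<^sub>k\<^sub>+\<^sub>1 X\<^sup>k v\<close>, with \<open>\<tau>\<^sub>k = \<epsilon> (f(\<beta>) + f(p\<beta>) + ... + f(p\<^sup>k\<^sup>-\<^sup>1\<beta>))\<close>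
  (\<open>p = q\<^sup>-\<^sup>2\<close> and \<open>\<epsilon> = 1\<close> if \<open>X = F\<close>, but \<open>p = q\<^sup>2\<close> and \<open>\<epsilon> = -1\<close> if \<open>X = E\<close>), so the vectors \<open>X\<^sup>k v\<close>
  span \<open>U/L\<close>. Let \<open>w\<close> be a combination of them with leading term \<open>X\<^sup>d v\<close>. If \<open>\<tau>\<^sub>1, ..., \<tau>\<^sub>d\<close> are
  nonzero, then \<open>Y\<^sup>d w\<close> is a nonzero multiple of \<open>v\<close>, so \<open>w\<close> generates the module. This yields
  irreducibility, and also the linear independence of the \<open>X\<^sup>k v\<close> when no \<open>\<tau>\<^sub>k\<close> with
  \<open>k \<ge> 1\<close> vanishes. A
  geometric sum shows that for \<open>X = F\<close> and \<open>k \<ge> 1\<close>, \<open>\<tau>\<^sub>k = 0\<close> exactly if \<open>\<beta>\<^sup>m = \<plusminus>q\<^sup>m\<^sup>(\<^sup>k\<^sup>-\<^sup>1\<^sup>)\<close>; as \<open>q\<close> is not a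
  root of unity this happens for at most one \<open>k\<close>, and there \<open>F\<^sup>k\<close> has been added to \<open>L\<close>, so that only
  \<open>v, Fv, ..., F\<^sup>k\<^sup>-\<^sup>1v\<close> remain. For \<open>X = E\<close> the hypothesis of the third part says that no \<open>\<tau>\<^sub>k\<close> with
  \<open>k \<ge> 1\<close> vanishes. This part of the argument is the locale \<open>cyclic_quotient\<close>.

  What remains for the modules is \<open>1 \<notin> L\<close>. It needs modules in which a nonzero vector satisfies the
  relations that define \<open>L\<close>. They come from one construction, the locale \<open>weight_module\<close>: \<open>K\<close> and \<open>EF\<close>
  act diagonally on the functions on \<open>\<int>\<close>, with the values that \<open>K\<close> and \<open>\<xi>\<close> take along the orbit of
  \<open>(\<alpha>, \<beta>)\<close> under \<open>\<theta>\<close>, while \<open>E\<close> and \<open>F\<close> shift the index. The factor \<open>\<xi>\<close> may be given to \<open>E\<close> or to \<open>F\<close>.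
  The first choice makes \<open>E\<close> annihilate the delta function at \<open>0\<close> when \<open>\<alpha> = f(\<beta>)\<close>, the second makes
  \<open>F\<close> annihilate it when \<open>\<alpha> = 0\<close>.

  The same modules settle the statements about \<open>\<theta>\<close>. On them \<open>R\<close> acts diagonally, so that elements
  of \<open>R\<close> become functions of the point \<open>(\<alpha>, \<beta>)\<close>. This is faithful (\<open>eval_faithful\<close>), because up to a
  power of \<open>K\<close> every element of \<open>R\<close> is a polynomial in \<open>K\<close> and \<open>\<xi>\<close>. Hence the automorphism \<open>\<theta>\<close> exists
  and is the pullback along a bijection of the points (\<open>theta_exists\<close>, \<open>eval_theta\<close>). As \<open>M\<^sub>\<alpha>\<^sub>,\<^sub>\<beta>\<close> contains all
  elements that vanish at \<open>(\<alpha>, \<beta>)\<close> (\<open>vanishing_in_M_ideal\<close>), both memberships become evaluations.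
\<close>

section \<open>Left ideals and their quotient modules\<close>

locale left_ideal = additive_subgroup L R + ring R for L and R (structure) +
  assumes absorb: "a \<in> carrier R \<Longrightarrow> x \<in> L \<Longrightarrow> a \<otimes> x \<in> L"

sublocale left_ideal \<subseteq> abelian_subgroup L R
  by (rule abelian_subgroupI3[OF additive_subgroup_axioms is_abelian_group])

text \<open>
  Closure under negation is automatic, since \<open>\<ominus> x\<close> is the left multiple of \<open>x\<close> by \<open>\<ominus> \<one>\<close>.
\<close>
lemma (in ring) left_idealI:
  assumes sub: "L \<subseteq> carrier R" and z: "\<zero> \<in> L"
    and add: "\<And>x y. x \<in> L \<Longrightarrow> y \<in> L \<Longrightarrow> x \<oplus> y \<in> L"
    and mult: "\<And>a x. a \<in> carrier R \<Longrightarrow> x \<in> L \<Longrightarrow> a \<otimes> x \<in> L"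
  shows "left_ideal L R"
proof (intro left_ideal.intro additive_subgroup.intro left_ideal_axioms.intro add.subgroupI)
  fix x assume "x \<in> L"
  then have "(\<ominus> \<one>) \<otimes> x \<in> L" by (intro mult) auto
  moreover have "x \<in> carrier R" using \<open>x \<in> L\<close> sub by auto
  ultimately show "\<ominus> x \<in> L" by (simp add: l_minus)
qed (use assms ring_axioms in auto)

context left_ideal
begin

text \<open>
  The scalar multiplication of the quotient is a union over the representatives of a coset.
  Absorption makes all members of that union equal.
\<close>
lemma quot_smult:
  assumes "a \<in> carrier R" "x \<in> carrier R"
  shows "a \<odot>\<^bsub>quot_module R L\<^esub> (L +> x) = L +> (a \<otimes> x)"
proof -
  have same: "L +> (a \<otimes> y) = L +> (a \<otimes> x)" if y: "y \<in> L +> x" for y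
  proof -
    obtain l where l: "l \<in> L" "y = l \<oplus> x"
      using y by (auto simp: a_r_coset_def r_coset_def)
    then have "a \<otimes> y = a \<otimes> l \<oplus> a \<otimes> x"
      using assms a_subset by (auto intro!: r_distr)
    then have "a \<otimes> y \<in> L +> (a \<otimes> x)"
      using absorb[OF assms(1) l(1)] by (auto simp: a_r_coset_def r_coset_def)
    then show ?thesis
      using a_repr_independence' assms by auto
  qed
  have "(\<Union>y\<in>L +> x. L +> (a \<otimes> y)) = (\<Union>y\<in>L +> x. L +> (a \<otimes> x))"
    using same by (rule SUP_cong[OF refl])
  also have "\<dots> = L +> (a \<otimes> x)"
    using a_rcos_self[OF assms(2)] by blast
  finally show ?thesis
    by (simp add: quot_module_def)
qed

lemma quot_add:
  "x \<in> carrier R \<Longrightarrow> y \<in> carrier R \<Longrightarrow>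
    (L +> x) \<oplus>\<^bsub>quot_module R L\<^esub> (L +> y) = L +> (x \<oplus> y)"
  by (simp add: quot_module_def a_rcos_sum)

lemma quot_zero: "\<zero>\<^bsub>quot_module R L\<^esub> = L"
  by (simp add: quot_module_def)

lemma quot_carrier: "carrier (quot_module R L) = (\<lambda>x. L +> x) ` carrier R"
  by (auto simp: quot_module_def A_RCOSETS_def')

lemma coset_in_quot: "x \<in> carrier R \<Longrightarrow> L +> x \<in> carrier (quot_module R L)"
  by (simp add: quot_carrier)

lemma coset_eq_iff:
  assumes "x \<in> carrier R" "y \<in> carrier R"
  shows "L +> x = L +> y \<longleftrightarrow> x \<ominus> y \<in> L"
  using a_rcos_module_minus[OF ring_axioms assms(2,1)] a_repr_independence'[of x y]
    a_repr_independenceD[of x y] assms by auto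

lemma coset_eq_self_iff: "x \<in> carrier R \<Longrightarrow> L +> x = L \<longleftrightarrow> x \<in> L"
  using coset_eq_iff[of x \<zero>] a_subset by (simp add: a_minus_def a_rcos_const)

lemma quot_abelian_group: "abelian_group (quot_module R L)"
proof (rule abelian_groupI)
  show "\<zero>\<^bsub>quot_module R L\<^esub> \<in> carrier (quot_module R L)"
    using coset_in_quot[of \<zero>] by (simp add: quot_zero a_subset)
  show "\<exists>D\<in>carrier (quot_module R L). D \<oplus>\<^bsub>quot_module R L\<^esub> C = \<zero>\<^bsub>quot_module R L\<^esub>"
    if C: "C \<in> carrier (quot_module R L)" for C
  proof -
    obtain x where x: "x \<in> carrier R" "C = L +> x" using C by (auto simp: quot_carrier)
    then have "(L +> \<ominus> x) \<oplus>\<^bsub>quot_module R L\<^esub> C = L"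
      by (simp add: quot_add l_neg a_subset)
    then show ?thesis using x coset_in_quot[of "\<ominus> x"] by (auto simp: quot_zero)
  qed
  show "\<zero>\<^bsub>quot_module R L\<^esub> \<oplus>\<^bsub>quot_module R L\<^esub> C = C"
    if "C \<in> carrier (quot_module R L)" for C
    using that quot_add[of \<zero>] by (auto simp: quot_carrier quot_zero a_subset)
qed (auto simp: quot_carrier quot_add a_ac)

lemma quot_left_module: "left_module R (quot_module R L)"
proof -
  interpret M: abelian_group "quot_module R L" by (rule quot_abelian_group)
  show ?thesis
    by (intro left_module.intro left_module_axioms.intro)
      (auto simp: quot_carrier quot_smult quot_add l_distr r_distr m_assoc
        intro: ring_axioms quot_abelian_group)
qed

text \<open>
  Submodules of \<open>R/L\<close> are the images of left ideals above \<open>L\<close>, and a left ideal that contains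
  \<open>\<one>\<close> is everything.
\<close>
lemma irreducible_quot_module:
  assumes one: "\<one> \<notin> L"
    and maximal: "\<And>J. left_ideal J R \<Longrightarrow> L \<subseteq> J \<Longrightarrow> J \<noteq> L \<Longrightarrow> \<one> \<in> J"
  shows "irreducible_module R (quot_module R L)"
  unfolding irreducible_module_def
proof (intro conjI allI impI)
  let ?M = "quot_module R L"
  interpret M: left_module R ?M by (rule quot_left_module)
  show "left_module R ?M" by (rule quot_left_module)
  have "L +> \<one> \<in> carrier ?M" "L +> \<one> \<noteq> L"
    using one by (auto simp: coset_in_quot coset_eq_self_iff)
  then show "carrier ?M \<noteq> {\<zero>\<^bsub>?M\<^esub>}" by (auto simp: quot_zero)
next
  let ?M = "quot_module R L"
  interpret M: left_module R ?M by (rule quot_left_module)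
  fix N assume "submodule N R ?M"
  then interpret N: submodule N R ?M .
  define J where "J = {x \<in> carrier R. L +> x \<in> N}"
  have zero_N: "L \<in> N" using N.one_closed by (simp add: quot_zero)
  have N_eq: "N = (\<lambda>x. L +> x) ` J"
    using N.subset by (auto simp: J_def quot_carrier)
  have J: "left_ideal J R"
  proof (rule left_idealI)
    show "\<zero> \<in> J" using zero_N a_coset_add_zero[OF a_subset] by (simp add: J_def)
    show "x \<oplus> y \<in> J" if "x \<in> J" "y \<in> J" for x y
      using that N.m_closed[of "L +> x" "L +> y"] by (simp add: J_def quot_add)
    show "a \<otimes> x \<in> J" if "a \<in> carrier R" "x \<in> J" for a x
      using that N.smult_closed[of a "L +> x"] by (simp add: J_def quot_smult)
  qed (auto simp: J_def)
  have LJ: "L \<subseteq> J"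
    using a_subset zero_N by (auto simp: J_def a_rcos_const)
  show "N = {\<zero>\<^bsub>?M\<^esub>} \<or> N = carrier ?M"
  proof (cases "J = L")
    case True
    then have "N = {L}" 
      using a_rcos_const zero_N by (auto simp: N_eq)
    then show ?thesis by (simp add: quot_zero)
  next
    case False
    interpret J: left_ideal J R by (rule J)
    have "\<one> \<in> J" by (rule maximal[OF J LJ False])
    then have "carrier R \<subseteq> J" using J.absorb by fastforce
    then have "J = carrier R" using J.a_subset by auto
    then show ?thesis by (simp add: N_eq quot_carrier)
  qed
qed

end

text \<open>
  For \<open>RP\<close>, \<open>Re\<close> and the sum of two left ideals, three facts suffice for what follows: each is a
  left ideal, it contains its generators, and it lies in every left ideal that contains them.
\<close>

context ring
begin

lemma left_ideal_ideal_prod: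
  assumes P: "P \<subseteq> carrier R" "p \<in> P"
  shows "left_ideal (ideal_prod R (carrier R) P) R"
proof (rule left_idealI)
  have carr: "x \<in> carrier R" if "x \<in> ideal_prod R (carrier R) P" for x
    using that by induction (use P in auto)
  then show "ideal_prod R (carrier R) P \<subseteq> carrier R" by auto
  show "\<zero> \<in> ideal_prod R (carrier R) P"
    using ideal_prod.prod[of \<zero> "carrier R" p P R] P by auto
  show "a \<otimes> x \<in> ideal_prod R (carrier R) P"
    if a: "a \<in> carrier R" and "x \<in> ideal_prod R (carrier R) P" for a x
    using that(2)
  proof induction
    case (prod i j)
    then have "(a \<otimes> i) \<otimes> j \<in> ideal_prod R (carrier R) P"
      using a by (intro ideal_prod.prod) auto
    then show ?case using a prod P by (auto simp: m_assoc)
  next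
    case (sum x y)
    then show ?case using a by (auto simp: r_distr carr intro: ideal_prod.sum)
  qed
qed (rule ideal_prod.sum)

lemma ideal_prod_carrier_superset:
  "P \<subseteq> carrier R \<Longrightarrow> P \<subseteq> ideal_prod R (carrier R) P"
  using ideal_prod.prod[of \<one> "carrier R" _ P R] by fastforce

lemma ideal_prod_carrier_minimal:
  assumes "left_ideal J R" "P \<subseteq> J"
  shows "ideal_prod R (carrier R) P \<subseteq> J"
proof
  interpret J: left_ideal J R by fact
  fix x assume "x \<in> ideal_prod R (carrier R) P"
  then show "x \<in> J" by induction (use assms J.absorb in auto)
qed

lemma left_ideal_carrier_mult:
  assumes "e \<in> carrier R"
  shows "left_ideal (carrier R #> e) R"
proof (rule left_idealI)
  show "\<zero> \<in> carrier R #> e"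
    using assms by (auto simp: r_coset_def intro!: bexI[of _ \<zero>])
  show "x \<oplus> y \<in> carrier R #> e" if "x \<in> carrier R #> e" "y \<in> carrier R #> e" for x y
    using that assms by (auto simp: r_coset_def l_distr[symmetric])
  show "a \<otimes> x \<in> carrier R #> e" if "a \<in> carrier R" "x \<in> carrier R #> e" for a x
    using that assms by (auto simp: r_coset_def m_assoc[symmetric])
qed (use assms in \<open>auto simp: r_coset_def\<close>)

lemma carrier_mult_self: "e \<in> carrier R \<Longrightarrow> e \<in> carrier R #> e"
  by (auto simp: r_coset_def intro!: bexI[of _ \<one>])

lemma carrier_mult_minimal:
  assumes "left_ideal J R" "e \<in> J"
  shows "carrier R #> e \<subseteq> J"
  using assms left_ideal.absorb[OF assms(1)] by (auto simp: r_coset_def)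

lemma left_ideal_set_add:
  assumes "left_ideal A R" "left_ideal B R"
  shows "left_ideal (set_add R A B) R"
proof -
  interpret A: left_ideal A R by fact
  interpret B: left_ideal B R by fact
  have memI: "a \<oplus> b \<in> set_add R A B" if "a \<in> A" "b \<in> B" for a b
    using that A.zero_closed B.zero_closed unfolding set_add_def' by blast
  show ?thesis
  proof (rule left_idealI)
    show "\<zero> \<in> set_add R A B"
      using memI[OF A.zero_closed B.zero_closed] by simp
    show "x \<oplus> y \<in> set_add R A B" if xy: "x \<in> set_add R A B" "y \<in> set_add R A B" for x y
    proof -
      obtain a b where ab: "a \<in> A" "b \<in> B" "x = a \<oplus> b" using xy by (auto simp: set_add_def')
      obtain c d where cd: "c \<in> A" "d \<in> B" "y = c \<oplus> d" using xy by (auto simp: set_add_def')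
      have "x \<oplus> y = (a \<oplus> c) \<oplus> (b \<oplus> d)"
        using ab cd by (simp add: a_ac A.a_Hcarr B.a_Hcarr)
      then show ?thesis using ab cd by (auto intro: memI)
    qed
    show "r \<otimes> x \<in> set_add R A B" if r: "r \<in> carrier R" and x: "x \<in> set_add R A B" for r x
    proof -
      obtain a b where ab: "a \<in> A" "b \<in> B" "x = a \<oplus> b" using x by (auto simp: set_add_def')
      then have "r \<otimes> x = r \<otimes> a \<oplus> r \<otimes> b" using r by (simp add: r_distr)
      then show ?thesis using ab r A.absorb B.absorb by (auto intro: memI)
    qed
  qed (use A.a_subset B.a_subset in \<open>auto simp: set_add_def'\<close>)
qed

lemma set_add_superset:
  assumes "left_ideal A R" "left_ideal B R"
  shows "A \<subseteq> set_add R A B" "B \<subseteq> set_add R A B"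
proof -
  interpret A: left_ideal A R by fact
  interpret B: left_ideal B R by fact
  have "x \<oplus> \<zero> \<in> set_add R A B" if "x \<in> A" for x
    using that A.zero_closed B.zero_closed unfolding set_add_def' by blast
  then show "A \<subseteq> set_add R A B" by auto
  have "\<zero> \<oplus> x \<in> set_add R A B" if "x \<in> B" for x
    using that A.zero_closed B.zero_closed unfolding set_add_def' by blast
  then show "B \<subseteq> set_add R A B" by auto
qed

lemma set_add_minimal:
  assumes "left_ideal J R" "A \<subseteq> J" "B \<subseteq> J"
  shows "set_add R A B \<subseteq> J"
proof -
  interpret J: left_ideal J R by fact
  show ?thesis using assms by (auto simp: set_add_def')
qed

end

section \<open>The free algebra and its quotient\<close>

lemma free_scalar_simps [simp]:
  "free_scalar 0 = 0" "free_scalar 1 = 1"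
  by (simp_all add: free_scalar_def flip: zero_list_def)

lemma free_scalar_add: "free_scalar (c + d) = free_scalar c + free_scalar d"
  and free_scalar_mult: "free_scalar (c * d) = free_scalar c * free_scalar d"
  and free_scalar_minus: "free_scalar (- c) = - free_scalar c"
  and free_scalar_diff: "free_scalar (c - d) = free_scalar c - free_scalar d"
  by (simp_all add: free_scalar_def single_add single_uminus single_diff mult_single plus_list_def)

lemma free_elem_induct [case_names single add]:
  fixes p :: free_elem
  assumes "\<And>w c. P (Poly_Mapping.single w c)"
    and "\<And>p r. P p \<Longrightarrow> P r \<Longrightarrow> P (p + r)"
  shows "P p"
proof (induction p rule: update_induct)
  case const
  then show ?case using assms(1)[of "[]" 0] by simp
next
  case (update f a b)
  have "Poly_Mapping.update a b f = f + Poly_Mapping.single a b"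
    using update(1) by (intro poly_mapping_eqI)
      (auto simp: lookup_update lookup_add lookup_single in_keys_iff when_def)
  then show ?case using update assms by simp
qed

lemma free_scalar_central: "p * free_scalar c = free_scalar c * p"
  by (induction p rule: free_elem_induct)
    (simp_all add: free_scalar_def mult_single plus_list_def distrib_left distrib_right mult.commute)

lemma free_scalar_left_commute: "u * (free_scalar c * v) = free_scalar c * (u * v)"
  by (metis free_scalar_central mult.assoc)

lemma free_scalar_left_assoc: "free_scalar c * (free_scalar d * v) = free_scalar (c * d) * v"
  by (simp add: free_scalar_mult mult.assoc)
text \<open>
  Words grow on the left, the side on which letters act on modules and on left ideals.
\<close>
lemma free_elem_letter_induct [case_names scalar add smult letter]:
  fixes p :: free_elem
  assumes one: "P 1"
    and add: "\<And>p r. P p \<Longrightarrow> P r \<Longrightarrow> P (p + r)"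
    and smult: "\<And>c p. P p \<Longrightarrow> P (free_scalar c * p)"
    and letter: "\<And>g p. P p \<Longrightarrow> P (letter g * p)"
  shows "P p"
proof (induction p rule: free_elem_induct)
  case (single w c)
  have "P (Poly_Mapping.single w 1)"
  proof (induction w)
    case Nil
    then show ?case using one by (simp flip: zero_list_def)
  next
    case (Cons g w)
    then show ?case using letter[OF Cons, of g]
      by (simp add: letter_def mult_single plus_list_def)
  qed
  from smult[OF this, of c] show ?case
    by (simp add: free_scalar_def mult_single plus_list_def)
qed (rule add)

lemma free_alg_simps [simp]:
  "carrier free_alg = UNIV" "x \<otimes>\<^bsub>free_alg\<^esub> y = x * y" "x \<oplus>\<^bsub>free_alg\<^esub> y = x + y"
  "\<one>\<^bsub>free_alg\<^esub> = 1" "\<zero>\<^bsub>free_alg\<^esub> = 0"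
  by (simp_all add: ring_of_type_algebra_def)

interpretation free: ring free_alg
  by (intro ringI abelian_groupI monoidI)
    (auto simp: algebra_simps intro: exI[of _ "- x" for x])

lemma free_alg_uminus [simp]: "\<ominus>\<^bsub>free_alg\<^esub> x = - x"
  by (rule free.minus_equality) simp_all

lemma free_alg_minus [simp]: "x \<ominus>\<^bsub>free_alg\<^esub> y = x - y"
  by (simp add: free.minus_eq)

lemma free_alg_power [simp]: "x [^]\<^bsub>free_alg\<^esub> (n::nat) = x ^ n"
  by (induction n) (simp_all add: power_commutes)

abbreviation (input) "lE \<equiv> letter GenE"
abbreviation (input) "lF \<equiv> letter GenF"
abbreviation (input) "lK \<equiv> letter GenK"
abbreviation (input) "lK' \<equiv> letter GenKinv"

lemma f_eval_free:
  "f_eval free_alg free_scalar q m x y = free_scalar (1 / (q - inverse q)) * (x ^ m - y ^ m)"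
  by (simp add: f_eval_def)

context
  fixes q :: complex and m :: nat
begin

interpretation I: ideal "U_ideal q m" free_alg
  unfolding U_ideal_def by (rule free.genideal_ideal) simp

lemma U_ideal_mult_left: "x \<in> U_ideal q m \<Longrightarrow> a * x \<in> U_ideal q m"
  using I.I_l_closed by simp

lemma U_ideal_mult_right: "x \<in> U_ideal q m \<Longrightarrow> x * a \<in> U_ideal q m"
  using I.I_r_closed by simp

lemma U_ideal_relations:
  "lK * lE - free_scalar (q ^ 2) * lE * lK \<in> U_ideal q m"
  "lK * lF - free_scalar (inverse q ^ 2) * lF * lK \<in> U_ideal q m"
  "lK * lK' - 1 \<in> U_ideal q m"
  "lK' * lK - 1 \<in> U_ideal q m"
  "lE * lF - lF * lE - free_scalar (1 / (q - inverse q)) * (lK ^ m - lK' ^ m) \<in> U_ideal q m"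
  using free.genideal_self[of "U_relators q m"]
  by (simp_all add: U_ideal_def U_relators_def Let_def f_eval_free)

lemma U_alg_ring: "ring (U_alg q m)"
  unfolding U_alg_def by (rule I.quotient_is_ring)

lemma U_class_hom: "ring_hom_ring free_alg (U_alg q m) (U_class q m)"
  unfolding U_alg_def U_class_def[abs_def] by (rule I.rcos_ring_hom_ring)

interpretation U: ring "U_alg q m" by (rule U_alg_ring)
interpretation c: ring_hom_ring free_alg "U_alg q m" "U_class q m" by (rule U_class_hom)

lemma U_class_closed [simp]: "U_class q m p \<in> carrier (U_alg q m)"
  using c.hom_closed by simp

lemma U_class_surj:
  assumes "u \<in> carrier (U_alg q m)"
  obtains p where "u = U_class q m p"
  using assms by (auto simp: U_alg_def FactRing_def A_RCOSETS_def' U_class_def)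

lemma U_class_eq_iff: "U_class q m p = U_class q m r \<longleftrightarrow> p - r \<in> U_ideal q m"
proof -
  have *: "p \<in> U_ideal q m +>\<^bsub>free_alg\<^esub> r \<longleftrightarrow> p - r \<in> U_ideal q m"
    using I.a_rcos_module[of r p] by simp
  show ?thesis
  proof
    assume "U_class q m p = U_class q m r"
    then have "p \<in> U_ideal q m +>\<^bsub>free_alg\<^esub> r"
      by (intro I.a_repr_independenceD) (simp_all add: U_class_def)
    with * show "p - r \<in> U_ideal q m" by simp
  next
    assume "p - r \<in> U_ideal q m"
    with * have "U_ideal q m +>\<^bsub>free_alg\<^esub> r = U_ideal q m +>\<^bsub>free_alg\<^esub> p"
      by (intro I.a_repr_independence') simp_all
    then show "U_class q m p = U_class q m r" by (simp add: U_class_def)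
  qed
qed

lemma U_class_add: "U_class q m p \<oplus>\<^bsub>U_alg q m\<^esub> U_class q m r = U_class q m (p + r)"
  and U_class_mult: "U_class q m p \<otimes>\<^bsub>U_alg q m\<^esub> U_class q m r = U_class q m (p * r)"
  and U_class_one: "\<one>\<^bsub>U_alg q m\<^esub> = U_class q m 1"
  and U_class_zero: "\<zero>\<^bsub>U_alg q m\<^esub> = U_class q m 0"
  and U_class_uminus: "\<ominus>\<^bsub>U_alg q m\<^esub> U_class q m p = U_class q m (- p)"
  using c.hom_add[of p r] c.hom_mult[of p r] c.hom_one c.hom_zero c.hom_a_inv[of p] by simp_all

lemma U_class_diff: "U_class q m p \<ominus>\<^bsub>U_alg q m\<^esub> U_class q m r = U_class q m (p - r)"
  by (simp add: a_minus_def U_class_add U_class_uminus)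

lemma U_class_power: "U_class q m p [^]\<^bsub>U_alg q m\<^esub> (n::nat) = U_class q m (p ^ n)"
  by (induction n) (simp_all add: U_class_one U_class_mult power_commutes)

lemmas U_class_simps = U_class_add U_class_mult U_class_one U_class_zero U_class_uminus
  U_class_diff U_class_power

lemmas U_gen_defs = E_gen_def F_gen_def K_gen_def Kinv_gen_def U_scalar_def xi_def U_class_mult

end

subsection \<open>Polynomials in one element\<close>

text \<open>
  The free algebra is not commutative, but evaluating at a single element is still compatible with
  sums and scalar multiples, because scalars are central.
\<close>
definition poly_at :: "free_elem \<Rightarrow> complex poly \<Rightarrow> free_elem" where
  "poly_at x P = fold_coeffs (\<lambda>c u. free_scalar c + x * u) P 0"

lemma poly_at_0 [simp]: "poly_at x 0 = 0"
  by (simp add: poly_at_def)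

lemma poly_at_pCons [simp]: "poly_at x (pCons c P) = free_scalar c + x * poly_at x P"
  by (cases "P = 0 \<and> c = 0") (auto simp: poly_at_def)

lemma poly_at_1 [simp]: "poly_at x 1 = 1"
  unfolding one_pCons by (simp del: one_poly_eq_simps)

lemma poly_at_add: "poly_at x (P + Q) = poly_at x P + poly_at x Q"
  by (induction P Q rule: poly_induct2) (simp_all add: free_scalar_add algebra_simps)

lemma poly_at_smult: "poly_at x (smult c P) = free_scalar c * poly_at x P"
  by (induction P)
    (simp_all add: free_scalar_mult distrib_left,
     metis (no_types, lifting) free_scalar_central mult.assoc)

lemma poly_at_diff: "poly_at x (P - Q) = poly_at x P - poly_at x Q"
  using poly_at_add[of x "P - Q" Q] by simp

lemma poly_at_monom: "poly_at x (monom c k) = free_scalar c * x ^ k"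
proof (induction k)
  case (Suc k)
  have "x * (free_scalar c * x ^ k) = free_scalar c * (x * x ^ k)"
    by (metis free_scalar_central mult.assoc)
  then show ?case using Suc by (simp add: monom_Suc)
qed (simp add: monom_0)

lemma poly_at_sum: "poly_at x (sum f A) = (\<Sum>k\<in>A. poly_at x (f k))"
  by (induction A rule: infinite_finite_induct) (simp_all add: poly_at_add)

lemma poly_at_altdef:
  "poly_at x P = (\<Sum>k\<le>degree P. free_scalar (coeff P k) * x ^ k)"
  by (subst poly_as_sum_of_monoms[symmetric]) (simp add: poly_at_sum poly_at_monom)

lemma poly_at_closure:
  assumes zero: "S 0" and add: "\<And>u v. S u \<Longrightarrow> S v \<Longrightarrow> S (u + v)"
    and monom: "\<And>c k. S (free_scalar c * x ^ k)"
  shows "S (poly_at x P)"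
proof -
  have "S (\<Sum>k\<in>A. free_scalar (coeff P k) * x ^ k)" for A :: "nat set"
    by (induction A rule: infinite_finite_induct) (simp_all add: assms)
  then show ?thesis by (simp add: poly_at_altdef)
qed

section \<open>Weight modules\<close>

text \<open>
  The index \<open>j\<close> stands for the \<open>j\<close>-th point of an orbit of \<open>\<theta>\<close>, at which \<open>K\<close> takes the value \<open>\<kappa> j\<close>. The
  operator of \<open>EF\<close> is multiplication by \<open>a j * b j\<close>, and that of \<open>FE\<close> is multiplication by
  \<open>a (j - 1) * b (j - 1)\<close>, so only the product of \<open>a\<close> and \<open>b\<close> is restricted by the relations of \<open>U\<close>.
\<close>
fun letter_op ::
  "(int \<Rightarrow> complex) \<Rightarrow> (int \<Rightarrow> complex) \<Rightarrow> (int \<Rightarrow> complex) \<Rightarrow> gen \<Rightarrow> (int \<Rightarrow> complex) \<Rightarrow> int \<Rightarrow> complex"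
  where
    "letter_op \<kappa> a b GenE g j = a j * g (j + 1)"
  | "letter_op \<kappa> a b GenF g j = b (j - 1) * g (j - 1)"
  | "letter_op \<kappa> a b GenK g j = \<kappa> j * g j"
  | "letter_op \<kappa> a b GenKinv g j = inverse (\<kappa> j) * g j"

definition word_op where
  "word_op \<kappa> a b w g = foldr (letter_op \<kappa> a b) w g"

definition free_act ::
  "(int \<Rightarrow> complex) \<Rightarrow> (int \<Rightarrow> complex) \<Rightarrow> (int \<Rightarrow> complex) \<Rightarrow> free_elem \<Rightarrow> (int \<Rightarrow> complex) \<Rightarrow> int \<Rightarrow> complex"
  where
    "free_act \<kappa> a b p g j =
       (\<Sum>w\<in>Poly_Mapping.keys p. Poly_Mapping.lookup p w * word_op \<kappa> a b w g j)"

context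
  fixes \<kappa> a b :: "int \<Rightarrow> complex"
begin

private abbreviation "act \<equiv> free_act \<kappa> a b"

lemma letter_op_linear:
  "letter_op \<kappa> a b x (\<lambda>j. c * g j + d * h j) =
    (\<lambda>j. c * letter_op \<kappa> a b x g j + d * letter_op \<kappa> a b x h j)"
  by (cases x) (auto simp: algebra_simps)

lemma word_op_linear:
  "word_op \<kappa> a b w (\<lambda>j. c * g j + d * h j) =
    (\<lambda>j. c * word_op \<kappa> a b w g j + d * word_op \<kappa> a b w h j)"
  by (induction w) (simp_all add: word_op_def letter_op_linear)

lemma act_superset:
  assumes "finite A" "Poly_Mapping.keys p \<subseteq> A"
  shows "act p g j = (\<Sum>w\<in>A. Poly_Mapping.lookup p w * word_op \<kappa> a b w g j)"
  unfolding free_act_def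
  by (rule sum.mono_neutral_left) (use assms in \<open>auto simp: in_keys_iff\<close>)

lemma act_single [simp]: "act (Poly_Mapping.single w c) g j = c * word_op \<kappa> a b w g j"
  by (subst act_superset[of "{w}"]) auto

lemma act_add [simp]: "act (p + r) g j = act p g j + act r g j"
proof -
  let ?A = "Poly_Mapping.keys p \<union> Poly_Mapping.keys r"
  have "Poly_Mapping.keys (p + r) \<subseteq> ?A" by (rule Poly_Mapping.keys_add)
  then show ?thesis
    by (simp add: act_superset[of ?A] lookup_add distrib_right sum.distrib)
qed

lemma act_zero [simp]: "act 0 g j = 0"
  by (simp add: free_act_def)

lemma act_uminus [simp]: "act (- p) g j = - act p g j"
  using act_add[of p "- p" g j] by (simp add: eq_neg_iff_add_eq_0 add.commute)

lemma act_diff [simp]: "act (p - r) g j = act p g j - act r g j"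
  using act_add[of p "- r" g j] by simp

lemma act_linear: "act p (\<lambda>j. c * g j + d * h j) = (\<lambda>j. c * act p g j + d * act p h j)"
  by (rule ext, induction p rule: free_elem_induct) (simp_all add: word_op_linear algebra_simps)

lemma act_cmult: "act p (\<lambda>j. c * g j) = (\<lambda>j. c * act p g j)"
  using act_linear[of p c g 0 g] by simp

lemma act_plus: "act p (\<lambda>j. g j + h j) = (\<lambda>j. act p g j + act p h j)"
  using act_linear[of p 1 g 1 h] by simp

lemma act_mult: "act (p * r) g = act p (act r g)"
proof (induction p rule: free_elem_induct)
  case (single w c)
  show ?case
  proof (induction r rule: free_elem_induct)
    case (single v d)
    have "act (Poly_Mapping.single v d) g = (\<lambda>j. d * word_op \<kappa> a b v g j)" by auto
    then show ?case
      using word_op_linear[of w d "word_op \<kappa> a b v g" 0 "\<lambda>_. 0"]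
      by (auto simp: mult_single plus_list_def word_op_def)
  next
    case (add p r)
    have "act (p + r) g = (\<lambda>j. act p g j + act r g j)" by auto
    then show ?case using add by (auto simp: distrib_left act_plus)
  qed
next
  case (add p r)
  then show ?case by (auto simp: distrib_right)
qed

lemma act_one [simp]: "act 1 g = g"
  by (auto simp flip: free_scalar_simps simp: free_scalar_def word_op_def)

lemma act_scalar [simp]: "act (free_scalar c) g = (\<lambda>j. c * g j)"
  by (auto simp: free_scalar_def word_op_def)

lemma act_letter: "act (letter x) g = letter_op \<kappa> a b x g"
  by (auto simp: letter_def word_op_def)

lemma act_K_pow [simp]: "act (lK ^ n) g = (\<lambda>j. \<kappa> j ^ n * g j)"
  by (induction n) (auto simp: act_mult act_letter fun_eq_iff)

lemma act_Kinv_pow [simp]: "act (lK' ^ n) g = (\<lambda>j. inverse (\<kappa> j) ^ n * g j)"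
  by (induction n) (auto simp: act_mult act_letter fun_eq_iff)

end

definition f_val :: "complex \<Rightarrow> nat \<Rightarrow> complex \<Rightarrow> complex" where
  "f_val q m x = (x ^ m - inverse x ^ m) / (q - inverse q)"

locale weight_module =
  fixes q :: complex and m :: nat and \<kappa> a b :: "int \<Rightarrow> complex"
  assumes q_nz: "q \<noteq> 0"
    and \<kappa>_nz: "\<kappa> j \<noteq> 0"
    and \<kappa>_step: "q ^ 2 * \<kappa> (j + 1) = \<kappa> j"
    and ab_step: "a (j + 1) * b (j + 1) = a j * b j + f_val q m (\<kappa> (j + 1))"
begin

abbreviation "act \<equiv> free_act \<kappa> a b"

text \<open>
  The elements that act as zero form a two-sided ideal. The two recurrences on \<open>\<kappa>\<close> and \<open>a * b\<close> put
  the relators into it.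
\<close>
lemma act_U_ideal:
  assumes "p \<in> U_ideal q m"
  shows "act p g = (\<lambda>_. 0)"
proof -
  let ?N = "{p. \<forall>g. act p g = (\<lambda>_. 0)}"
  have "ideal ?N free_alg"
  proof (rule idealI)
    show "ring free_alg" by (rule free.ring_axioms)
    show "subgroup ?N (add_monoid free_alg)"
      by (rule free.add.subgroupI) (auto simp: fun_eq_iff intro: exI[of _ 0])
  qed (auto simp: act_mult act_cmult[of _ _ _ _ 0, simplified])
  moreover have "U_relators q m \<subseteq> ?N"
  proof -
    have KE: "\<kappa> j * (a j * x) - q ^ 2 * (a j * (\<kappa> (j + 1) * x)) = 0" for j x
      using \<kappa>_step[of j] by (simp add: algebra_simps)
    have KF: "\<kappa> j * (b (j - 1) * x) - inverse q ^ 2 * (b (j - 1) * (\<kappa> (j - 1) * x)) = 0" for j x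
      using \<kappa>_step[of "j - 1"] q_nz by (simp add: field_simps)
    have EF: "a j * (b j * x) - b (j - 1) * (a (j - 1) * x) -
      (\<kappa> j ^ m * x - inverse (\<kappa> j) ^ m * x) / (q - inverse q) = 0" for j x
    proof -
      have "a j * (b j * x) - b (j - 1) * (a (j - 1) * x) = (a j * b j - a (j - 1) * b (j - 1)) * x"
        by (simp add: algebra_simps)
      also have "a j * b j - a (j - 1) * b (j - 1) = f_val q m (\<kappa> j)"
        using ab_step[of "j - 1"] by simp
      finally show ?thesis by (simp add: f_val_def left_diff_distrib)
    qed
    have "act (lK * lE - free_scalar (q ^ 2) * lE * lK) g j = 0" for g j
      using KE by (simp add: act_mult act_letter)
    moreover have "act (lK * lF - free_scalar (inverse q ^ 2) * lF * lK) g j = 0" for g j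
      using KF by (simp add: act_mult act_letter)
    moreover have "act (lK * lK' - 1) g j = 0" for g j
      using \<kappa>_nz by (simp add: act_mult act_letter)
    moreover have "act (lK' * lK - 1) g j = 0" for g j
      using \<kappa>_nz by (simp add: act_mult act_letter)
    moreover have "act (lE * lF - lF * lE - f_eval free_alg free_scalar q m lK lK') g j = 0" for g j
      using EF[of j "g j"] by (simp add: f_eval_free act_mult act_letter)
    ultimately show ?thesis
      unfolding U_relators_def Let_def fun_eq_iff by blast
  qed
  ultimately have "U_ideal q m \<subseteq> ?N"
    unfolding U_ideal_def by (rule free.genideal_minimal)
  then show ?thesis using assms by auto
qed

text \<open>
  Any representative of the class gives the same operator, by the preceding lemma.
\<close>
definition uact :: "free_elem set \<Rightarrow> (int \<Rightarrow> complex) \<Rightarrow> int \<Rightarrow> complex" where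
  "uact u = act (SOME p. U_class q m p = u)"

lemma uact_class [simp]: "uact (U_class q m p) = act p"
proof -
  define r where "r = (SOME r. U_class q m r = U_class q m p)"
  have "U_class q m r = U_class q m p"
    unfolding r_def by (rule someI[of _ p]) simp
  then have "r - p \<in> U_ideal q m" by (simp add: U_class_eq_iff)
  from act_U_ideal[OF this] have "act r g j = act p g j" for g j
    by (metis act_diff eq_iff_diff_eq_0)
  then show ?thesis by (auto simp: uact_def r_def)
qed

lemma uact_add:
  assumes "u \<in> carrier (U_alg q m)" "v \<in> carrier (U_alg q m)"
  shows "uact (u \<oplus>\<^bsub>U_alg q m\<^esub> v) g j = uact u g j + uact v g j"
  using assms by (elim U_class_surj) (simp add: U_class_simps)

lemma uact_mult:
  assumes "u \<in> carrier (U_alg q m)" "v \<in> carrier (U_alg q m)"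
  shows "uact (u \<otimes>\<^bsub>U_alg q m\<^esub> v) g = uact u (uact v g)"
  using assms by (elim U_class_surj) (simp add: U_class_simps act_mult)

lemma uact_uminus:
  assumes "u \<in> carrier (U_alg q m)"
  shows "uact (\<ominus>\<^bsub>U_alg q m\<^esub> u) g j = - uact u g j"
  using assms by (elim U_class_surj) (simp add: U_class_simps)

text \<open>
  This is the tool for \<open>1 \<notin> L\<close>: if the generators of \<open>L\<close> send \<open>v\<close> into a submodule \<open>S\<close> with \<open>v \<notin> S\<close>, then
  all of \<open>L\<close> does, whereas \<open>1\<close> does not.
\<close>
lemma left_ideal_stable_subspace:
  assumes zero: "(\<lambda>_. 0) \<in> S"
    and lin: "\<And>g h c d. g \<in> S \<Longrightarrow> h \<in> S \<Longrightarrow> (\<lambda>j. c * g j + d * h j) \<in> S"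
    and letters: "\<And>x g. g \<in> S \<Longrightarrow> letter_op \<kappa> a b x g \<in> S"
  shows "left_ideal {u \<in> carrier (U_alg q m). uact u v \<in> S} (U_alg q m)"
proof -
  interpret U: ring "U_alg q m" by (rule U_alg_ring)
  have stable: "act p g \<in> S" if "g \<in> S" for p g
  proof (induction p rule: free_elem_letter_induct)
    case (add p r)
    have "act (p + r) g = (\<lambda>j. 1 * act p g j + 1 * act r g j)" by auto
    then show ?case using lin[OF add, of 1 1] by metis
  next
    case (smult c p)
    then show ?case using lin[of "act p g" "act p g" c 0] by (simp add: act_mult)
  qed (use that letters in \<open>auto simp: act_mult act_letter\<close>)
  show ?thesis
  proof (rule U.left_idealI)
    fix u w assume "u \<in> {u \<in> carrier (U_alg q m). uact u v \<in> S}"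
      "w \<in> {u \<in> carrier (U_alg q m). uact u v \<in> S}"
    moreover from this have "uact (u \<oplus>\<^bsub>U_alg q m\<^esub> w) v = (\<lambda>j. 1 * uact u v j + 1 * uact w v j)"
      by (auto simp: uact_add)
    ultimately show "u \<oplus>\<^bsub>U_alg q m\<^esub> w \<in> {u \<in> carrier (U_alg q m). uact u v \<in> S}"
      using lin[of "uact u v" "uact w v" 1 1] by auto
  next
    fix u w assume "u \<in> carrier (U_alg q m)" "w \<in> {u \<in> carrier (U_alg q m). uact u v \<in> S}"
    then show "u \<otimes>\<^bsub>U_alg q m\<^esub> w \<in> {u \<in> carrier (U_alg q m). uact u v \<in> S}"
      using stable by (elim U_class_surj) (auto simp: uact_mult elim!: U_class_surj)
  next
    have "act 0 v = (\<lambda>_. 0)" by auto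
    then show "\<zero>\<^bsub>U_alg q m\<^esub> \<in> {u \<in> carrier (U_alg q m). uact u v \<in> S}"
      using zero by (simp add: U_class_zero)
  qed auto
qed

end

section \<open>The commutative subalgebra \<open>R\<close>\<close>

context
  fixes q :: complex and m :: nat
begin

interpretation U: ring "U_alg q m" by (rule U_alg_ring)

lemma U_gens_closed [simp]:
  "E_gen q m \<in> carrier (U_alg q m)" "F_gen q m \<in> carrier (U_alg q m)"
  "K_gen q m \<in> carrier (U_alg q m)" "Kinv_gen q m \<in> carrier (U_alg q m)"
  "U_scalar q m c \<in> carrier (U_alg q m)" "xi q m \<in> carrier (U_alg q m)"
  by (simp_all add: U_gen_defs)

lemma R_alg_simps [simp]:
  "u \<otimes>\<^bsub>R_alg q m\<^esub> v = u \<otimes>\<^bsub>U_alg q m\<^esub> v" "u \<oplus>\<^bsub>R_alg q m\<^esub> v = u \<oplus>\<^bsub>U_alg q m\<^esub> v"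
  "\<one>\<^bsub>R_alg q m\<^esub> = \<one>\<^bsub>U_alg q m\<^esub>" "\<zero>\<^bsub>R_alg q m\<^esub> = \<zero>\<^bsub>U_alg q m\<^esub>"
  by (simp_all add: R_alg_def)

lemma R_gens_subset:
  "range (U_scalar q m) \<union> {xi q m, K_gen q m, Kinv_gen q m} \<subseteq> carrier (U_alg q m)"
  by auto

lemma R_alg_ring: "ring (R_alg q m)"
  unfolding R_alg_def by (rule U.generate_ring_is_ring[OF R_gens_subset])

interpretation R: ring "R_alg q m" by (rule R_alg_ring)

lemma R_in_U: "r \<in> carrier (R_alg q m) \<Longrightarrow> r \<in> carrier (U_alg q m)"
  using U.generate_ring_in_carrier[OF R_gens_subset] by (simp add: R_alg_def)

lemma R_gens_closed [simp]:
  "K_gen q m \<in> carrier (R_alg q m)" "Kinv_gen q m \<in> carrier (R_alg q m)"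
  "U_scalar q m c \<in> carrier (R_alg q m)" "xi q m \<in> carrier (R_alg q m)"
  by (auto simp: R_alg_def intro: generate_ring.incl)

lemma R_closed:
  assumes "u \<in> carrier (R_alg q m)" "v \<in> carrier (R_alg q m)"
  shows "u \<oplus>\<^bsub>U_alg q m\<^esub> v \<in> carrier (R_alg q m)" "u \<otimes>\<^bsub>U_alg q m\<^esub> v \<in> carrier (R_alg q m)"
  using R.a_closed[OF assms] R.m_closed[OF assms] by simp_all

lemma R_uminus:
  assumes "u \<in> carrier (R_alg q m)"
  shows "\<ominus>\<^bsub>R_alg q m\<^esub> u = \<ominus>\<^bsub>U_alg q m\<^esub> u"
  using R.l_neg[OF assms] assms R.a_inv_closed[OF assms]
  by (intro U.minus_equality[symmetric]) (auto intro: R_in_U)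

lemma U_scalar_one: "U_scalar q m 1 = \<one>\<^bsub>U_alg q m\<^esub>"
  by (simp add: U_scalar_def U_class_one)

lemma R_induct [consumes 1, case_names scalar K Kinv xi add mult]:
  assumes r: "r \<in> carrier (R_alg q m)"
    and gens: "\<And>c. P (U_scalar q m c)" "P (K_gen q m)" "P (Kinv_gen q m)" "P (xi q m)"
    and add: "\<And>u v. u \<in> carrier (R_alg q m) \<Longrightarrow> v \<in> carrier (R_alg q m) \<Longrightarrow> P u \<Longrightarrow> P v \<Longrightarrow>
       P (u \<oplus>\<^bsub>U_alg q m\<^esub> v)"
    and mult: "\<And>u v. u \<in> carrier (R_alg q m) \<Longrightarrow> v \<in> carrier (R_alg q m) \<Longrightarrow> P u \<Longrightarrow> P v \<Longrightarrow>
       P (u \<otimes>\<^bsub>U_alg q m\<^esub> v)"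
  shows "P r"
proof -
  let ?G = "range (U_scalar q m) \<union> {xi q m, K_gen q m, Kinv_gen q m}"
  have carr: "carrier (R_alg q m) = generate_ring (U_alg q m) ?G"
    by (simp add: R_alg_def)
  from r have "r \<in> generate_ring (U_alg q m) ?G" by (simp add: R_alg_def)
  then show ?thesis
  proof induction
    case one
    then show ?case using gens(1)[of 1] by (simp add: U_scalar_one)
  next
    case (incl h)
    then show ?case using gens by auto
  next
    case (a_inv h)
    then have h: "h \<in> carrier (R_alg q m)" by (simp add: carr)
    then obtain p where p: "h = U_class q m p" by (meson R_in_U U_class_surj)
    have "U_scalar q m (-1) \<otimes>\<^bsub>U_alg q m\<^esub> h = \<ominus>\<^bsub>U_alg q m\<^esub> h"
      by (simp add: p U_scalar_def U_class_simps free_scalar_minus)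
    moreover have "P (U_scalar q m (-1) \<otimes>\<^bsub>U_alg q m\<^esub> h)"
      using a_inv gens(1)[of "-1"] h by (intro mult) auto
    ultimately show ?case by simp
  qed (use add mult carr in auto)
qed

lemma U_class_cong_mult:
  "U_class q m p = U_class q m p' \<Longrightarrow> U_class q m r = U_class q m r' \<Longrightarrow>
    U_class q m (p * r) = U_class q m (p' * r')"
  by (metis U_class_mult)

lemma U_class_cong_add:
  "U_class q m p = U_class q m p' \<Longrightarrow> U_class q m r = U_class q m r' \<Longrightarrow>
    U_class q m (p + r) = U_class q m (p' + r')"
  by (metis U_class_add)

lemma U_relations:
  "U_class q m (lK * lE) = U_class q m (free_scalar (q ^ 2) * lE * lK)"
  "U_class q m (lK * lF) = U_class q m (free_scalar (inverse q ^ 2) * lF * lK)"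
  "U_class q m (lK * lK') = U_class q m 1"
  "U_class q m (lK' * lK) = U_class q m 1"
  using U_ideal_relations[where q = q and m = m] by (simp_all add: U_class_eq_iff)

lemma K_xi_commute:
  assumes "q \<noteq> 0"
  shows "U_class q m (lK * (lE * lF)) = U_class q m ((lE * lF) * lK)"
proof -
  have "U_class q m (lK * (lE * lF)) = U_class q m ((lK * lE) * lF)" by (simp add: mult.assoc)
  also have "\<dots> = U_class q m ((free_scalar (q ^ 2) * lE * lK) * lF)"
    by (rule U_class_cong_mult[OF U_relations(1) refl])
  also have "\<dots> = U_class q m ((free_scalar (q ^ 2) * lE) * (lK * lF))" by (simp add: mult.assoc)
  also have "\<dots> = U_class q m ((free_scalar (q ^ 2) * lE) * (free_scalar (inverse q ^ 2) * lF * lK))"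
    by (rule U_class_cong_mult[OF refl U_relations(2)])
  also have "(free_scalar (q ^ 2) * lE) * (free_scalar (inverse q ^ 2) * lF * lK) =
      free_scalar (q ^ 2 * inverse q ^ 2) * ((lE * lF) * lK)"
    by (metis (no_types, lifting) free_scalar_central free_scalar_mult mult.assoc)
  also have "q ^ 2 * inverse q ^ 2 = 1" using assms by (simp add: field_simps)
  finally show ?thesis by simp
qed

lemma Kpow_xi_commute:
  assumes "q \<noteq> 0"
  shows "U_class q m (lK ^ n * (lE * lF)) = U_class q m ((lE * lF) * lK ^ n)"
proof (induction n)
  case (Suc n)
  have "U_class q m (lK ^ Suc n * (lE * lF)) = U_class q m (lK * (lK ^ n * (lE * lF)))"
    by (simp add: mult.assoc)
  also have "\<dots> = U_class q m (lK * ((lE * lF) * lK ^ n))"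
    by (intro U_class_cong_mult Suc refl)
  also have "\<dots> = U_class q m ((lK * (lE * lF)) * lK ^ n)" by (simp add: mult.assoc)
  also have "\<dots> = U_class q m (((lE * lF) * lK) * lK ^ n)"
    by (intro U_class_cong_mult K_xi_commute assms refl)
  finally show ?case by (simp add: mult.assoc)
qed auto

text \<open>
  The outer variable is \<open>\<xi> = EF\<close> and the inner one is \<open>K\<close>. Powers of \<open>\<xi>\<close> stand to the left of powers of \<open>K\<close>;
  modulo the relations the order does not matter.
\<close>
definition ev_K_xi :: "complex poly poly \<Rightarrow> free_elem" where
  "ev_K_xi P = fold_coeffs (\<lambda>p u. poly_at lK p + (lE * lF) * u) P 0"

lemma ev_K_xi_0 [simp]: "ev_K_xi 0 = 0"
  by (simp add: ev_K_xi_def)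

lemma ev_K_xi_pCons [simp]: "ev_K_xi (pCons p P) = poly_at lK p + (lE * lF) * ev_K_xi P"
  by (cases "P = 0 \<and> p = 0") (auto simp: ev_K_xi_def)

lemma ev_K_xi_add: "ev_K_xi (P + Q) = ev_K_xi P + ev_K_xi Q"
  by (induction P Q rule: poly_induct2) (simp_all add: poly_at_add algebra_simps)

lemma ev_K_xi_smult: "ev_K_xi (smult [:c:] P) = free_scalar c * ev_K_xi P"
  by (induction P)
    (simp_all add: poly_at_smult distrib_left,
     metis (no_types, lifting) free_scalar_central mult.assoc)

lemma ev_K_xi_K:
  assumes "q \<noteq> 0"
  shows "U_class q m (ev_K_xi (smult [:0, 1:] P)) = U_class q m (lK * ev_K_xi P)"
proof (induction P)
  case (pCons p P)
  have "U_class q m (lE * lF * ev_K_xi (smult [:0, 1:] P)) = U_class q m (lE * lF * (lK * ev_K_xi P))"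
    by (intro U_class_cong_mult pCons.IH refl)
  also have "\<dots> = U_class q m (((lE * lF) * lK) * ev_K_xi P)" by (simp add: mult.assoc)
  also have "\<dots> = U_class q m ((lK * (lE * lF)) * ev_K_xi P)"
    by (intro U_class_cong_mult K_xi_commute[symmetric] assms refl)
  finally have "U_class q m (lE * lF * ev_K_xi (smult [:0, 1:] P)) = U_class q m (lK * (lE * lF * ev_K_xi P))"
    by (simp add: mult.assoc)
  then have "U_class q m (lK * poly_at lK p + lE * lF * ev_K_xi (smult [:0, 1:] P)) =
      U_class q m (lK * poly_at lK p + lK * (lE * lF * ev_K_xi P))"
    by (intro U_class_cong_add refl)
  then show ?case by (simp add: distrib_left)
qed auto

lemma ev_K_xi_Kpow:
  assumes "q \<noteq> 0"
  shows "\<exists>Q. U_class q m (lK ^ n * ev_K_xi P) = U_class q m (ev_K_xi Q)"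
proof (induction n)
  case (Suc n)
  then obtain Q where "U_class q m (lK ^ n * ev_K_xi P) = U_class q m (ev_K_xi Q)" by blast
  then have "U_class q m (lK * (lK ^ n * ev_K_xi P)) = U_class q m (lK * ev_K_xi Q)"
    by (intro U_class_cong_mult refl)
  also have "\<dots> = U_class q m (ev_K_xi (smult [:0, 1:] Q))"
    by (rule ev_K_xi_K[OF assms, symmetric])
  finally show ?case by (auto simp: mult.assoc)
qed auto

text \<open>
  Since \<open>K\<close> is invertible, the elements of \<open>R\<close> are Laurent polynomials. Clearing the negative powers
  of \<open>K\<close> leaves an ordinary polynomial in \<open>K\<close> and \<open>\<xi>\<close>.
\<close>
definition has_numerator :: "free_elem set \<Rightarrow> bool" where
  "has_numerator u \<longleftrightarrow>
     (\<exists>n P. U_class q m (lK ^ n) \<otimes>\<^bsub>U_alg q m\<^esub> u = U_class q m (ev_K_xi P))"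

lemma has_numerator_class:
  "has_numerator (U_class q m p) \<longleftrightarrow> (\<exists>n P. U_class q m (lK ^ n * p) = U_class q m (ev_K_xi P))"
  by (simp add: has_numerator_def U_class_mult)

lemma R_has_numerator:
  assumes q: "q \<noteq> 0" and r: "r \<in> carrier (R_alg q m)"
  shows "has_numerator r"
proof -
  let ?c = "U_class q m"
  \<comment> \<open>Multiplying by a whole element \<open>r\<close> on the left makes the product case of the induction trivial.\<close>
  have *: "has_numerator (r \<otimes>\<^bsub>U_alg q m\<^esub> u)" if "has_numerator u" "u \<in> carrier (U_alg q m)" for u
    using r that
  proof (induction arbitrary: u rule: R_induct)
    case (scalar c)
    then obtain p where p: "u = ?c p" by (metis U_class_surj)
    obtain n P where nP: "?c (lK ^ n * p) = ?c (ev_K_xi P)"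
      using scalar by (auto simp: p has_numerator_class)
    have "?c (lK ^ n * (free_scalar c * p)) = ?c (free_scalar c * (lK ^ n * p))"
      by (metis free_scalar_central mult.assoc)
    also have "\<dots> = ?c (free_scalar c * ev_K_xi P)" by (intro U_class_cong_mult nP refl)
    also have "\<dots> = ?c (ev_K_xi (smult [:c:] P))" by (simp add: ev_K_xi_smult)
    finally show ?case by (auto simp: p U_scalar_def U_class_mult has_numerator_class)
  next
    case K
    then obtain p where p: "u = ?c p" by (metis U_class_surj)
    obtain n P where nP: "?c (lK ^ n * p) = ?c (ev_K_xi P)"
      using K by (auto simp: p has_numerator_class)
    have "?c (lK ^ n * (lK * p)) = ?c (lK * (lK ^ n * p))"
      by (metis mult.assoc power_commutes)
    also have "\<dots> = ?c (lK * ev_K_xi P)" by (intro U_class_cong_mult nP refl)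
    also have "\<dots> = ?c (ev_K_xi (smult [:0, 1:] P))" by (simp add: ev_K_xi_K q)
    finally show ?case by (auto simp: p K_gen_def U_class_mult has_numerator_class)
  next
    case Kinv
    then obtain p where p: "u = ?c p" by (metis U_class_surj)
    obtain n P where nP: "?c (lK ^ n * p) = ?c (ev_K_xi P)"
      using Kinv by (auto simp: p has_numerator_class)
    have "?c (lK ^ Suc n * (lK' * p)) = ?c (lK ^ n * ((lK * lK') * p))"
      by (simp only: mult.assoc power_Suc2)
    also have "\<dots> = ?c (lK ^ n * (1 * p))"
      by (intro U_class_cong_mult[OF refl] U_class_cong_mult[OF U_relations(3) refl])
    finally have "?c (lK ^ Suc n * (lK' * p)) = ?c (ev_K_xi P)" using nP by simp
    then show ?case by (auto simp: p Kinv_gen_def U_class_mult has_numerator_class simp del: power_Suc)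
  next
    case xi
    then obtain p where p: "u = ?c p" by (metis U_class_surj)
    obtain n P where nP: "?c (lK ^ n * p) = ?c (ev_K_xi P)"
      using xi by (auto simp: p has_numerator_class)
    have "?c (lK ^ n * (lE * lF * p)) = ?c ((lK ^ n * (lE * lF)) * p)"
      by (simp add: mult.assoc)
    also have "\<dots> = ?c (((lE * lF) * lK ^ n) * p)"
      by (intro U_class_cong_mult Kpow_xi_commute q refl)
    also have "\<dots> = ?c ((lE * lF) * (lK ^ n * p))" by (simp add: mult.assoc)
    also have "\<dots> = ?c ((lE * lF) * ev_K_xi P)" by (intro U_class_cong_mult nP refl)
    also have "\<dots> = ?c (ev_K_xi (pCons 0 P))" by simp
    finally show ?case by (auto simp: p U_gen_defs has_numerator_class simp del: ev_K_xi_pCons)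
  next
    case (add v w)
    obtain p where p: "u = ?c p" using add by (metis U_class_surj)
    obtain x where x: "v = ?c x" using add by (metis R_in_U U_class_surj)
    obtain y where y: "w = ?c y" using add by (metis R_in_U U_class_surj)
    obtain k P where kP: "?c (lK ^ k * (x * p)) = ?c (ev_K_xi P)"
      using add(3)[OF add(5,6)] by (auto simp: x p U_class_mult has_numerator_class)
    obtain l Q where lQ: "?c (lK ^ l * (y * p)) = ?c (ev_K_xi Q)"
      using add(4)[OF add(5,6)] by (auto simp: y p U_class_mult has_numerator_class)
    obtain P' where P': "?c (lK ^ l * ev_K_xi P) = ?c (ev_K_xi P')" using ev_K_xi_Kpow[OF q] by blast
    obtain Q' where Q': "?c (lK ^ k * ev_K_xi Q) = ?c (ev_K_xi Q')" using ev_K_xi_Kpow[OF q] by blast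
    have "lK ^ (k + l) * ((x + y) * p) = lK ^ l * (lK ^ k * (x * p)) + lK ^ k * (lK ^ l * (y * p))"
    proof -
      have "lK ^ (k + l) * (x * p) = lK ^ l * (lK ^ k * (x * p))"
        by (simp only: add.commute[of k l] power_add mult.assoc)
      moreover have "lK ^ (k + l) * (y * p) = lK ^ k * (lK ^ l * (y * p))"
        by (simp only: power_add mult.assoc)
      ultimately show ?thesis by (simp only: distrib_left distrib_right)
    qed
    also have "?c \<dots> = ?c (lK ^ l * ev_K_xi P + lK ^ k * ev_K_xi Q)"
      by (intro U_class_cong_mult U_class_cong_add kP lQ refl)
    also have "\<dots> = ?c (ev_K_xi P' + ev_K_xi Q')"
      by (intro U_class_cong_add P' Q')
    finally have "?c (lK ^ (k + l) * ((x + y) * p)) = ?c (ev_K_xi (P' + Q'))"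
      by (simp add: ev_K_xi_add)
    then show ?case by (auto simp: p x y U_class_simps has_numerator_class)
  next
    case (mult v w)
    then have "has_numerator (v \<otimes>\<^bsub>U_alg q m\<^esub> (w \<otimes>\<^bsub>U_alg q m\<^esub> u))"
      by (auto intro: R_in_U)
    then show ?case using mult by (simp add: U.m_assoc R_in_U)
  qed
  have "has_numerator (?c 1)"
    unfolding has_numerator_class by (rule exI[of _ 0], rule exI[of _ "[:1:]"]) simp
  from *[OF this] show ?thesis using R_in_U[OF r] by (simp add: U_class_one[symmetric])
qed

lemma Kpow_cancel:
  "U_class q m (lK ^ n * p) = U_class q m 0 \<Longrightarrow> U_class q m p = U_class q m 0"
proof (induction n)
  case (Suc n)
  have "U_class q m (lK ^ n * p) = U_class q m (1 * (lK ^ n * p))" by simp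
  also have "\<dots> = U_class q m ((lK' * lK) * (lK ^ n * p))"
    by (rule U_class_cong_mult[OF U_relations(4)[symmetric] refl])
  also have "\<dots> = U_class q m (lK' * (lK ^ Suc n * p))" by (simp add: mult.assoc)
  also have "\<dots> = U_class q m (lK' * 0)" by (intro U_class_cong_mult Suc.prems refl)
  finally show ?case using Suc.IH by simp
qed auto

end

context weight_module
begin

interpretation U: ring "U_alg q m" by (rule U_alg_ring)
interpretation R: ring "R_alg q m" by (rule R_alg_ring)

lemma uact_gens [simp]:
  "uact (U_scalar q m c) g j = c * g j" "uact (K_gen q m) g j = \<kappa> j * g j"
  "uact (Kinv_gen q m) g j = inverse (\<kappa> j) * g j" "uact (xi q m) g j = a j * b j * g j"
  "uact (E_gen q m) g j = a j * g (j + 1)" "uact (F_gen q m) g j = b (j - 1) * g (j - 1)"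
  by (simp_all add: U_gen_defs act_mult act_letter)

lemma uact_one: "uact \<one>\<^bsub>U_alg q m\<^esub> g = g"
  by (simp add: U_class_one)

definition wt :: "free_elem set \<Rightarrow> int \<Rightarrow> complex" where
  "wt r j = uact r (\<lambda>_. 1) j"

text \<open>
  The generators of \<open>R\<close> act diagonally, hence so does all of \<open>R\<close>; the constant function \<open>1\<close> reads off the
  eigenvalues.
\<close>
lemma uact_R: "r \<in> carrier (R_alg q m) \<Longrightarrow> uact r g j = wt r j * g j"
proof (induction arbitrary: g rule: R_induct)
  case (add u v)
  have "uact (u \<oplus>\<^bsub>U_alg q m\<^esub> v) h j = wt u j * h j + wt v j * h j" for h
    using add(1,2) by (simp only: uact_add R_in_U add(3) add(4))
  from this[of g] this[of "\<lambda>_. 1"] show ?case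
    by (simp add: wt_def[of "u \<oplus>\<^bsub>U_alg q m\<^esub> v"] distrib_right)
next
  case (mult u v)
  have "uact (u \<otimes>\<^bsub>U_alg q m\<^esub> v) h j = wt u j * (wt v j * h j)" for h
    using mult(1,2) by (simp only: uact_mult R_in_U mult(3) mult(4))
  from this[of g] this[of "\<lambda>_. 1"] show ?case by (simp add: wt_def[of "u \<otimes>\<^bsub>U_alg q m\<^esub> v"])
qed (simp_all add: wt_def)

lemma wt_gens [simp]:
  "wt (U_scalar q m c) j = c" "wt (K_gen q m) j = \<kappa> j"
  "wt (Kinv_gen q m) j = inverse (\<kappa> j)" "wt (xi q m) j = a j * b j"
  by (simp_all add: wt_def)

lemma wt_add:
  "u \<in> carrier (R_alg q m) \<Longrightarrow> v \<in> carrier (R_alg q m) \<Longrightarrow>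
    wt (u \<oplus>\<^bsub>U_alg q m\<^esub> v) j = wt u j + wt v j"
  by (simp add: wt_def uact_add R_in_U)

lemma wt_mult:
  "u \<in> carrier (R_alg q m) \<Longrightarrow> v \<in> carrier (R_alg q m) \<Longrightarrow>
    wt (u \<otimes>\<^bsub>U_alg q m\<^esub> v) j = wt u j * wt v j"
  using uact_R[of u "uact v (\<lambda>_. 1)"] by (simp add: wt_def uact_mult R_in_U)

lemma wt_minus:
  "u \<in> carrier (R_alg q m) \<Longrightarrow> v \<in> carrier (R_alg q m) \<Longrightarrow>
    wt (u \<ominus>\<^bsub>R_alg q m\<^esub> v) j = wt u j - wt v j"
  using R.a_inv_closed[of v]
  by (simp add: a_minus_def wt_add R_uminus) (simp add: wt_def uact_uminus R_in_U)

lemma wt_power: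
  "u \<in> carrier (R_alg q m) \<Longrightarrow> wt (u [^]\<^bsub>R_alg q m\<^esub> (n::nat)) j = wt u j ^ n"
proof (induction n)
  case 0
  then show ?case by (simp add: wt_def uact_one)
next
  case (Suc n)
  then show ?case using R.nat_pow_closed[of u n] R.nat_pow_Suc[of u n] by (simp add: wt_mult)
qed

lemma wt_f_eval:
  assumes "u \<in> carrier (R_alg q m)" "v \<in> carrier (R_alg q m)"
  shows "wt (f_eval (R_alg q m) (U_scalar q m) q m u v) j = (wt u j ^ m - wt v j ^ m) / (q - inverse q)"
  using assms R.nat_pow_closed by (simp add: f_eval_def wt_mult wt_minus wt_power)

lemma act_poly_at: "act (poly_at lK p) g j = poly p (\<kappa> j) * g j"
  by (induction p) (auto simp: act_mult act_letter distrib_right)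

lemma act_ev_K_xi: "act (ev_K_xi P) g j = poly (poly P [:a j * b j:]) (\<kappa> j) * g j"
  by (induction P arbitrary: g j) (auto simp: act_mult act_letter distrib_right act_poly_at mult.assoc)

end

section \<open>The orbit modules and the automorphism \<open>\<theta>\<close>\<close>

text \<open>
  These are the values of \<open>K\<close> and \<open>\<xi>\<close> along the orbit of \<open>(\<alpha>, \<beta>)\<close>. By \<open>casimir_part_step\<close> below,
  \<open>casimir_part\<close> is an antiderivative of \<open>f\<close> for the step \<open>x \<mapsto> q\<^sup>2x\<close>. So \<open>\<xi> - casimir_part(K)\<close> is
  invariant under \<open>\<theta>\<close> (it is a Casimir element of \<open>U\<close>), which gives \<open>\<xi>\<close> in closed form along the orbit,
  in both directions.
\<close>
definition orbit_wt :: "complex \<Rightarrow> complex \<Rightarrow> int \<Rightarrow> complex" where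
  "orbit_wt q \<beta> j = \<beta> * q powi (- 2 * j)"

definition casimir_part :: "complex \<Rightarrow> nat \<Rightarrow> complex \<Rightarrow> complex" where
  "casimir_part q m x =
     (x ^ m + q ^ (2 * m) * inverse x ^ m) / ((1 - q ^ (2 * m)) * (q - inverse q))"

definition orbit_xi :: "complex \<Rightarrow> nat \<Rightarrow> complex \<Rightarrow> complex \<Rightarrow> int \<Rightarrow> complex" where
  "orbit_xi q m \<alpha> \<beta> j = \<alpha> - casimir_part q m \<beta> + casimir_part q m (orbit_wt q \<beta> j)"

lemma orbit_wt_0 [simp]: "orbit_wt q \<beta> 0 = \<beta>"
  by (simp add: orbit_wt_def)

lemma orbit_xi_0 [simp]: "orbit_xi q m \<alpha> \<beta> 0 = \<alpha>"
  by (simp add: orbit_xi_def)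

text \<open>
  These two maps describe \<open>\<theta>\<close> and its inverse on points \<open>(\<alpha>, \<beta>)\<close>, that is, on the maximal ideals of \<open>R\<close>.
\<close>
definition shift :: "complex \<Rightarrow> nat \<Rightarrow> complex \<times> complex \<Rightarrow> complex \<times> complex" where
  "shift q m = (\<lambda>(\<alpha>, \<beta>). (\<alpha> + f_val q m (inverse q ^ 2 * \<beta>), inverse q ^ 2 * \<beta>))"

definition shift_inv :: "complex \<Rightarrow> nat \<Rightarrow> complex \<times> complex \<Rightarrow> complex \<times> complex" where
  "shift_inv q m = (\<lambda>(\<alpha>, \<beta>). (\<alpha> - f_val q m \<beta>, q ^ 2 * \<beta>))"

text \<open>
  An element of \<open>R\<close> is read here as a Laurent polynomial in \<open>\<xi>\<close> and \<open>K\<close>, and evaluated at a point. That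
  this is well defined is a consequence of the weight module: the value is the eigenvalue at index \<open>0\<close>.
\<close>
definition eval_at :: "complex \<Rightarrow> nat \<Rightarrow> complex \<times> complex \<Rightarrow> free_elem set \<Rightarrow> complex" where
  "eval_at q m = (\<lambda>(\<alpha>, \<beta>) r.
     weight_module.wt q m (orbit_wt q \<beta>) (\<lambda>_. 1) (orbit_xi q m \<alpha> \<beta>) r 0)"

locale generic_q =
  fixes q :: complex and m :: nat
  assumes q_nz: "q \<noteq> 0"
    and not_root: "k \<ge> 1 \<Longrightarrow> q ^ k \<noteq> 1"
    and m_pos: "m \<ge> 1"
begin

lemma q_minus_nz: "q - inverse q \<noteq> 0"
proof
  assume "q - inverse q = 0"
  then have "q ^ 2 = 1" using q_nz by (simp add: field_simps power2_eq_square)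
  then show False using not_root[of 2] by simp
qed

lemma one_minus_power_nz: "k \<ge> 1 \<Longrightarrow> 1 - q ^ k \<noteq> 0"
  using not_root[of k] by auto

lemma casimir_part_step:
  assumes "x \<noteq> 0"
  shows "casimir_part q m x - casimir_part q m (q ^ 2 * x) = f_val q m x"
proof -
  define Q where "Q = q ^ (2 * m)"
  define y where "y = x ^ m"
  have nz: "1 - Q \<noteq> 0" "y \<noteq> 0" "Q \<noteq> 0"
    using one_minus_power_nz[of "2 * m"] m_pos assms q_nz by (auto simp: Q_def y_def)
  have Qm: "(q ^ 2 * x) ^ m = Q * y"
    by (simp add: Q_def y_def power_mult_distrib flip: power_mult)
  have "(y + Q * inverse y) / (1 - Q) - (Q * y + Q * inverse (Q * y)) / (1 - Q) = y - inverse y"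
  proof -
    have "Q * inverse (Q * y) = inverse y" using nz by simp
    then have "y + Q * inverse y - (Q * y + Q * inverse (Q * y)) = (1 - Q) * (y - inverse y)"
      by (simp add: algebra_simps)
    then show ?thesis using nz(1) by (simp flip: diff_divide_distrib)
  qed
  then have "((y + Q * inverse y) / (1 - Q) - (Q * y + Q * inverse (Q * y)) / (1 - Q)) / (q - inverse q)
      = (y - inverse y) / (q - inverse q)" by simp
  then show ?thesis
    unfolding casimir_part_def f_val_def power_inverse Qm y_def[symmetric] Q_def[symmetric]
    by (simp add: diff_divide_distrib)
qed

lemma orbit_weight_module:
  assumes "\<beta> \<noteq> 0" "\<And>j. a j * b j = orbit_xi q m \<alpha> \<beta> j"
  shows "weight_module q m (orbit_wt q \<beta>) a b"
proof
  show "q \<noteq> 0" by (rule q_nz)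
  show nz: "orbit_wt q \<beta> j \<noteq> 0" for j
    using assms(1) q_nz by (simp add: orbit_wt_def power_int_eq_0_iff)
  show step: "q ^ 2 * orbit_wt q \<beta> (j + 1) = orbit_wt q \<beta> j" for j
  proof -
    have "q powi (- 2 * j) = q powi (2 + - 2 * (j + 1))" by simp
    also have "\<dots> = q powi 2 * q powi (- 2 * (j + 1))"
      using q_nz by (intro power_int_add) simp
    finally show ?thesis by (simp add: orbit_wt_def)
  qed
  show "a (j + 1) * b (j + 1) = a j * b j + f_val q m (orbit_wt q \<beta> (j + 1))" for j
    using casimir_part_step[OF nz[of "j + 1"]] unfolding step assms(2) by (simp add: orbit_xi_def algebra_simps)
qed

lemma eval_weight_module:
  "\<beta> \<noteq> 0 \<Longrightarrow> weight_module q m (orbit_wt q \<beta>) (\<lambda>_. 1) (orbit_xi q m \<alpha> \<beta>)"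
  by (rule orbit_weight_module) simp_all

interpretation U: ring "U_alg q m" by (rule U_alg_ring)
interpretation R: ring "R_alg q m" by (rule R_alg_ring)

abbreviation "Rset \<equiv> carrier (R_alg q m)"
abbreviation "ev \<equiv> eval_at q m"
abbreviation "points \<equiv> {x :: complex \<times> complex. snd x \<noteq> 0}"

lemma eval_gens [simp]:
  assumes "x \<in> points"
  shows "ev x (U_scalar q m c) = c" "ev x (K_gen q m) = snd x"
    "ev x (Kinv_gen q m) = inverse (snd x)" "ev x (xi q m) = fst x"
proof -
  interpret W: weight_module q m "orbit_wt q (snd x)" "\<lambda>_. 1" "orbit_xi q m (fst x) (snd x)"
    using assms by (intro eval_weight_module) simp
  show "ev x (U_scalar q m c) = c" "ev x (K_gen q m) = snd x"
    "ev x (Kinv_gen q m) = inverse (snd x)" "ev x (xi q m) = fst x"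
    by (simp_all add: eval_at_def case_prod_unfold)
qed

lemma eval_ops [simp]:
  assumes "x \<in> points" "u \<in> Rset" "v \<in> Rset"
  shows "ev x (u \<oplus>\<^bsub>U_alg q m\<^esub> v) = ev x u + ev x v"
    "ev x (u \<otimes>\<^bsub>U_alg q m\<^esub> v) = ev x u * ev x v"
    "ev x (u \<ominus>\<^bsub>R_alg q m\<^esub> v) = ev x u - ev x v"
    "ev x (f_eval (R_alg q m) (U_scalar q m) q m u v) = (ev x u ^ m - ev x v ^ m) / (q - inverse q)"
proof -
  interpret W: weight_module q m "orbit_wt q (snd x)" "\<lambda>_. 1" "orbit_xi q m (fst x) (snd x)"
    using assms by (intro eval_weight_module) simp
  show "ev x (u \<oplus>\<^bsub>U_alg q m\<^esub> v) = ev x u + ev x v"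
    "ev x (u \<otimes>\<^bsub>U_alg q m\<^esub> v) = ev x u * ev x v"
    "ev x (u \<ominus>\<^bsub>R_alg q m\<^esub> v) = ev x u - ev x v"
    "ev x (f_eval (R_alg q m) (U_scalar q m) q m u v) = (ev x u ^ m - ev x v ^ m) / (q - inverse q)"
    using assms by (simp_all add: eval_at_def case_prod_unfold W.wt_add W.wt_mult W.wt_minus W.wt_f_eval)
qed

lemma f_eval_in_R: "u \<in> Rset \<Longrightarrow> v \<in> Rset \<Longrightarrow> f_eval (R_alg q m) (U_scalar q m) q m u v \<in> Rset"
  unfolding f_eval_def by (intro R.m_closed R.minus_closed R.nat_pow_closed) auto

text \<open>
  Evaluation sends the numerator of \<open>r\<close> to the values of a polynomial in two variables on
  \<open>\<complex> \<times> (\<complex> - {0})\<close>. A nonzero polynomial cannot vanish there, so the numerator is zero, and then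
  \<open>r\<close> is zero because \<open>K\<close> is invertible.
\<close>
lemma eval_faithful_zero:
  assumes r: "r \<in> Rset" and z: "\<And>x. x \<in> points \<Longrightarrow> ev x r = 0"
  shows "r = \<zero>\<^bsub>U_alg q m\<^esub>"
proof -
  obtain n P where nP: "U_class q m (lK ^ n) \<otimes>\<^bsub>U_alg q m\<^esub> r = U_class q m (ev_K_xi P)"
    using R_has_numerator[OF q_nz r] by (auto simp: has_numerator_def)
  have root: "poly (poly P [:\<alpha>:]) \<beta> = 0" if "\<beta> \<noteq> 0" for \<alpha> \<beta>
  proof -
    interpret W: weight_module q m "orbit_wt q \<beta>" "\<lambda>_. 1" "orbit_xi q m \<alpha> \<beta>"
      using that by (intro eval_weight_module) simp
    have "poly (poly P [:\<alpha>:]) \<beta> = W.uact (U_class q m (ev_K_xi P)) (\<lambda>_. 1) 0"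
      by (simp add: W.act_ev_K_xi)
    also have "\<dots> = \<beta> ^ n * ev (\<alpha>, \<beta>) r"
      using R_in_U[OF r] by (simp flip: nP add: W.uact_mult eval_at_def W.wt_def)
    also have "\<dots> = 0" using z[of "(\<alpha>, \<beta>)"] that by simp
    finally show ?thesis .
  qed
  have "poly P [:\<alpha>:] = 0" for \<alpha>
  proof (rule ccontr)
    assume "poly P [:\<alpha>:] \<noteq> 0"
    then have "finite {\<beta>. poly (poly P [:\<alpha>:]) \<beta> = 0}" by (rule poly_roots_finite)
    moreover have "UNIV - {0} \<subseteq> {\<beta>. poly (poly P [:\<alpha>:]) \<beta> = 0}" using root by auto
    ultimately have "finite (UNIV - {0 :: complex})" by (rule finite_subset[rotated])
    then show False by (simp add: infinite_UNIV_char_0)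
  qed
  then have "range (\<lambda>\<alpha>. [:\<alpha>:]) \<subseteq> {p. poly P p = 0}" by auto
  moreover have "infinite (range (\<lambda>\<alpha> :: complex. [:\<alpha>:]))"
    by (subst finite_image_iff) (auto simp: inj_on_def infinite_UNIV_char_0)
  ultimately have "P = 0"
    using poly_roots_finite[of P] finite_subset by blast
  obtain p where p: "r = U_class q m p" using R_in_U[OF r] by (rule U_class_surj)
  have "U_class q m (lK ^ n * p) = U_class q m 0" using nP by (simp add: p U_class_mult \<open>P = 0\<close>)
  from Kpow_cancel[OF this] show ?thesis by (simp add: p U_class_zero)
qed

lemma eval_faithful:
  assumes "r \<in> Rset" "s \<in> Rset" "\<And>x. x \<in> points \<Longrightarrow> ev x r = ev x s"
  shows "r = s"
proof -
  have "r \<ominus>\<^bsub>R_alg q m\<^esub> s = \<zero>\<^bsub>R_alg q m\<^esub>"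
    using eval_faithful_zero[of "r \<ominus>\<^bsub>R_alg q m\<^esub> s"] assms by simp
  then show ?thesis using assms(1,2) R.r_right_minus_eq[of r s] by simp
qed

lemma snd_shift_eq_0 [simp]:
  "snd (shift q m x) = 0 \<longleftrightarrow> snd x = 0" "snd (shift_inv q m x) = 0 \<longleftrightarrow> snd x = 0"
  using q_nz by (auto simp: shift_def shift_inv_def case_prod_unfold)

lemma shift_shift_inv [simp]:
  "shift q m (shift_inv q m x) = x" "shift_inv q m (shift q m x) = x"
  using q_nz by (auto simp: shift_def shift_inv_def field_simps split: prod.splits)

text \<open>
  A map \<open>\<tau>\<close> of the points acts on \<open>R\<close> by composition as soon as it pulls the generators back to
  functions that come from \<open>R\<close>.
\<close>
lemma pullback_exists:
  assumes r: "r \<in> Rset" and \<tau>: "\<And>x. x \<in> points \<Longrightarrow> \<tau> x \<in> points"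
    and gens: "\<exists>s\<in>Rset. \<forall>x\<in>points. ev x s = snd (\<tau> x)"
      "\<exists>s\<in>Rset. \<forall>x\<in>points. ev x s = inverse (snd (\<tau> x))"
      "\<exists>s\<in>Rset. \<forall>x\<in>points. ev x s = fst (\<tau> x)"
  shows "\<exists>s\<in>Rset. \<forall>x\<in>points. ev x s = ev (\<tau> x) r"
  using r
proof (induction rule: R_induct)
  case (scalar c)
  show ?case using \<tau> by (intro bexI[of _ "U_scalar q m c"]) auto
next
  case (add u v)
  then obtain s t where "s \<in> Rset" "t \<in> Rset"
    "\<forall>x\<in>points. ev x s = ev (\<tau> x) u" "\<forall>x\<in>points. ev x t = ev (\<tau> x) v" by blast
  then show ?case using \<tau> add(1,2)
    by (intro bexI[of _ "s \<oplus>\<^bsub>U_alg q m\<^esub> t"]) (auto simp: R_closed simp del: R_alg_simps)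
next
  case (mult u v)
  then obtain s t where "s \<in> Rset" "t \<in> Rset"
    "\<forall>x\<in>points. ev x s = ev (\<tau> x) u" "\<forall>x\<in>points. ev x t = ev (\<tau> x) v" by blast
  then show ?case using \<tau> mult(1,2)
    by (intro bexI[of _ "s \<otimes>\<^bsub>U_alg q m\<^esub> t"]) (auto simp: R_closed simp del: R_alg_simps)
qed (use gens \<tau> in auto)

abbreviation "cK c \<equiv> U_scalar q m c \<otimes>\<^bsub>U_alg q m\<^esub> K_gen q m"
abbreviation "cKinv c \<equiv> U_scalar q m c \<otimes>\<^bsub>U_alg q m\<^esub> Kinv_gen q m"

lemma eval_theta_gens:
  assumes x: "x \<in> points"
  shows "ev x (cK (inverse q ^ 2)) = snd (shift q m x)"
    "ev x (cKinv (q ^ 2)) = inverse (snd (shift q m x))"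
    "ev x (xi q m \<oplus>\<^bsub>U_alg q m\<^esub> f_eval (R_alg q m) (U_scalar q m) q m (cK (inverse q ^ 2)) (cKinv (q ^ 2)))
       = fst (shift q m x)"
proof -
  show K: "ev x (cK (inverse q ^ 2)) = snd (shift q m x)"
    using x by (simp add: shift_def case_prod_unfold)
  show K': "ev x (cKinv (q ^ 2)) = inverse (snd (shift q m x))"
    using x by (simp add: shift_def case_prod_unfold power_inverse)
  have "xi q m \<in> Rset" "cK (inverse q ^ 2) \<in> Rset" "cKinv (q ^ 2) \<in> Rset"
    by (auto intro: R_closed)
  then show "ev x (xi q m \<oplus>\<^bsub>U_alg q m\<^esub> f_eval (R_alg q m) (U_scalar q m) q m (cK (inverse q ^ 2)) (cKinv (q ^ 2)))
       = fst (shift q m x)"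
    using x by (simp only: eval_ops f_eval_in_R K K') (simp add: x shift_def case_prod_unfold f_val_def)
qed

text \<open>
  Whatever satisfies the defining conditions of \<open>\<theta>\<close> is the pullback along \<open>shift\<close>. With faithfulness
  this gives uniqueness.
\<close>
lemma is_theta_eval:
  assumes t: "is_theta q m t" and r: "r \<in> Rset" and x: "x \<in> points"
  shows "ev x (t r) = ev (shift q m x) r"
  using r
proof (induction rule: R_induct)
  note th = t[unfolded is_theta_def]
  have hom: "t \<in> ring_hom (R_alg q m) (R_alg q m)" using th by (simp add: ring_iso_def)
  have tK: "t (K_gen q m) = cK (inverse q ^ 2)" and tK': "t (Kinv_gen q m) = cKinv (q ^ 2)"
    using th by auto
  {
    case (scalar c)
    then show ?case using th x by simp
  next
    case K
    then show ?case using x eval_theta_gens(1)[OF x] by (simp add: tK)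
  next
    case Kinv
    then show ?case using x eval_theta_gens(2)[OF x] by (simp add: tK')
  next
    case xi
    have "t (xi q m) = xi q m \<oplus>\<^bsub>U_alg q m\<^esub>
        f_eval (R_alg q m) (U_scalar q m) q m (cK (inverse q ^ 2)) (cKinv (q ^ 2))"
      using th by auto
    then show ?case using x eval_theta_gens(3)[OF x] by simp
  next
    case (add u v)
    then show ?case
      using x ring_hom_add[OF hom, of u v] ring_hom_closed[OF hom] by simp
  next
    case (mult u v)
    then show ?case
      using x ring_hom_mult[OF hom, of u v] ring_hom_closed[OF hom] by simp
  }
qed

text \<open>
  Pullback along \<open>shift\<close> is well defined by faithfulness. It is injective because \<open>shift\<close> is surjective
  on points, and it is surjective because pullback along \<open>shift_inv\<close> also preserves \<open>R\<close>.
\<close>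
lemma theta_exists: "\<exists>t. t \<in> extensional Rset \<and> is_theta q m t"
proof -
  have fwd: "\<exists>s\<in>Rset. \<forall>x\<in>points. ev x s = ev (shift q m x) r" if "r \<in> Rset" for r
  proof (rule pullback_exists[OF that])
    show "\<exists>s\<in>Rset. \<forall>x\<in>points. ev x s = snd (shift q m x)"
      using eval_theta_gens(1) by (intro bexI[of _ "cK (inverse q ^ 2)"]) (auto intro: R_closed)
    show "\<exists>s\<in>Rset. \<forall>x\<in>points. ev x s = inverse (snd (shift q m x))"
      using eval_theta_gens(2) by (intro bexI[of _ "cKinv (q ^ 2)"]) (auto intro: R_closed)
    show "\<exists>s\<in>Rset. \<forall>x\<in>points. ev x s = fst (shift q m x)"
      using eval_theta_gens(3) by (intro bexI[of _ "xi q m \<oplus>\<^bsub>U_alg q m\<^esub>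
          f_eval (R_alg q m) (U_scalar q m) q m (cK (inverse q ^ 2)) (cKinv (q ^ 2))"])
        (blast, intro R_closed f_eval_in_R R_gens_closed)
  qed simp
  have bwd: "\<exists>s\<in>Rset. \<forall>x\<in>points. ev x s = ev (shift_inv q m x) r" if "r \<in> Rset" for r
  proof (rule pullback_exists[OF that])
    show "\<exists>s\<in>Rset. \<forall>x\<in>points. ev x s = snd (shift_inv q m x)"
      by (intro bexI[of _ "cK (q ^ 2)"]) (auto intro: R_closed simp: shift_inv_def)
    show "\<exists>s\<in>Rset. \<forall>x\<in>points. ev x s = inverse (snd (shift_inv q m x))"
      by (intro bexI[of _ "cKinv (inverse q ^ 2)"])
        (auto intro: R_closed simp: shift_inv_def power_inverse)
    show "\<exists>s\<in>Rset. \<forall>x\<in>points. ev x s = fst (shift_inv q m x)"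
      by (intro bexI[of _ "xi q m \<ominus>\<^bsub>R_alg q m\<^esub>
            f_eval (R_alg q m) (U_scalar q m) q m (K_gen q m) (Kinv_gen q m)"])
        (auto intro!: R.minus_closed f_eval_in_R simp: shift_inv_def f_val_def f_eval_in_R)
  qed simp
  define t where "t = (\<lambda>r\<in>Rset. SOME s. s \<in> Rset \<and> (\<forall>x\<in>points. ev x s = ev (shift q m x) r))"
  have t: "t r \<in> Rset \<and> (\<forall>x\<in>points. ev x (t r) = ev (shift q m x) r)" if "r \<in> Rset" for r
    using someI_ex[of "\<lambda>s. s \<in> Rset \<and> (\<forall>x\<in>points. ev x s = ev (shift q m x) r)"] fwd[OF that] that
    by (auto simp: t_def)
  have t_eq: "t r = s" if "r \<in> Rset" "s \<in> Rset" "\<And>x. x \<in> points \<Longrightarrow> ev x s = ev (shift q m x) r" for r s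
    using that t[OF that(1)] by (intro eval_faithful) auto
  have inj: "inj_on t Rset"
  proof (rule inj_onI)
    fix r s assume rs: "r \<in> Rset" "s \<in> Rset" "t r = t s"
    show "r = s"
    proof (rule eval_faithful)
      fix x assume x: "x \<in> points"
      then have y: "shift_inv q m x \<in> points" by simp
      have "ev x r = ev (shift_inv q m x) (t r)" using bspec[OF conjunct2[OF t[OF rs(1)]] y] by simp
      also have "\<dots> = ev x s" using bspec[OF conjunct2[OF t[OF rs(2)]] y] rs(3) by simp
      finally show "ev x r = ev x s" .
    qed (use rs in auto)
  qed
  have surj: "Rset \<subseteq> t ` Rset"
  proof
    fix s assume s: "s \<in> Rset"
    obtain r where r: "r \<in> Rset" "\<forall>x\<in>points. ev x r = ev (shift_inv q m x) s"
      using bwd[OF s] by blast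
    have "ev x s = ev (shift q m x) r" if "x \<in> points" for x
      using bspec[OF r(2), of "shift q m x"] that by simp
    then have "t r = s" by (rule t_eq[OF r(1) s])
    then show "s \<in> t ` Rset" using r by auto
  qed
  have "t \<in> ring_iso (R_alg q m) (R_alg q m)"
  proof (rule ring_iso_memI)
    show "t (u \<otimes>\<^bsub>R_alg q m\<^esub> v) = t u \<otimes>\<^bsub>R_alg q m\<^esub> t v" if "u \<in> Rset" "v \<in> Rset" for u v
      using that t by (intro t_eq) (auto simp: R_closed)
    show "t (u \<oplus>\<^bsub>R_alg q m\<^esub> v) = t u \<oplus>\<^bsub>R_alg q m\<^esub> t v" if "u \<in> Rset" "v \<in> Rset" for u v
      using that t by (intro t_eq) (auto simp: R_closed)
    show "t \<one>\<^bsub>R_alg q m\<^esub> = \<one>\<^bsub>R_alg q m\<^esub>"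
      by (intro t_eq) (auto simp flip: U_scalar_one)
    show "bij_betw t Rset Rset" using inj surj t by (auto simp: bij_betw_def)
  qed (use t in auto)
  moreover have "t (U_scalar q m c) = U_scalar q m c" for c by (rule t_eq) auto
  moreover have K: "t (K_gen q m) = cK (inverse q ^ 2)"
    using eval_theta_gens(1) by (intro t_eq) (auto intro: R_closed)
  moreover have K': "t (Kinv_gen q m) = cKinv (q ^ 2)"
    using eval_theta_gens(2) by (intro t_eq) (auto intro: R_closed)
  moreover have "t (xi q m) = xi q m \<oplus>\<^bsub>U_alg q m\<^esub>
      f_eval (R_alg q m) (U_scalar q m) q m (cK (inverse q ^ 2)) (cKinv (q ^ 2))"
    using eval_theta_gens(3) by (intro t_eq) (auto intro!: R_closed f_eval_in_R)
  ultimately have "is_theta q m t" by (simp add: is_theta_def)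
  moreover have "t \<in> extensional Rset" by (simp add: t_def)
  ultimately show ?thesis by blast
qed

lemma is_theta_theta: "is_theta q m (theta q m)"
proof -
  have "\<exists>!t. t \<in> extensional Rset \<and> is_theta q m t"
  proof (rule ex_ex1I[OF theta_exists])
    fix t t' assume tt': "t \<in> extensional Rset \<and> is_theta q m t" "t' \<in> extensional Rset \<and> is_theta q m t'"
    then have "t r \<in> Rset" "t' r \<in> Rset" if "r \<in> Rset" for r
      using that by (auto simp: is_theta_def ring_iso_def intro: ring_hom_closed)
    then have "t r = t' r" if "r \<in> Rset" for r
      using tt' that is_theta_eval by (intro eval_faithful) auto
    then show "t = t'" using tt' by (intro extensionalityI[of t Rset t']) auto
  qed
  from theI'[OF this] show ?thesis by (simp add: theta_def)
qed

lemma theta_closed: "r \<in> Rset \<Longrightarrow> theta q m r \<in> Rset"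
  using is_theta_theta by (auto simp: is_theta_def ring_iso_def intro: ring_hom_closed)

lemma eval_theta: "r \<in> Rset \<Longrightarrow> x \<in> points \<Longrightarrow> ev x (theta q m r) = ev (shift q m x) r"
  by (rule is_theta_eval[OF is_theta_theta])

lemma eval_theta_power:
  assumes "r \<in> Rset" "x \<in> points"
  shows "(theta q m ^^ n) r \<in> Rset \<and> ev x ((theta q m ^^ n) r) = ev ((shift q m ^^ n) x) r"
  using assms
proof (induction n arbitrary: x)
  case (Suc n)
  then show ?case using theta_closed eval_theta
    by (simp del: funpow.simps add: funpow_Suc_right[of n "shift q m"]) (simp add: funpow.simps)
qed auto

text \<open>
  \<open>theta_inv\<close> is an \<open>inv_into\<close>, so bijectivity of \<open>\<theta>\<close> on \<open>R\<close> is what gives it a meaning.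
\<close>
lemma eval_theta_inv:
  assumes "r \<in> Rset" "x \<in> points"
  shows "theta_inv q m r \<in> Rset" "ev x (theta_inv q m r) = ev (shift_inv q m x) r"
proof -
  have im: "theta q m ` Rset = Rset"
    using is_theta_theta by (auto simp: is_theta_def ring_iso_def bij_betw_def)
  then show closed: "theta_inv q m r \<in> Rset"
    using assms unfolding theta_inv_def by (intro inv_into_into) simp
  have "theta q m (theta_inv q m r) = r"
    using assms im unfolding theta_inv_def by (intro f_inv_into_f) simp
  then show "ev x (theta_inv q m r) = ev (shift_inv q m x) r"
    using eval_theta[OF closed, of "shift_inv q m x"] assms by simp
qed

lemma M_gens_in_R:
  "{xi q m \<ominus>\<^bsub>R_alg q m\<^esub> U_scalar q m \<alpha>, K_gen q m \<ominus>\<^bsub>R_alg q m\<^esub> U_scalar q m \<beta>} \<subseteq> Rset"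
  by auto

lemma M_ideal_ideal: "ideal (M_ideal q m \<alpha> \<beta>) (R_alg q m)"
  unfolding M_ideal_def by (rule R.genideal_ideal[OF M_gens_in_R])

lemma M_ideal_subset: "M_ideal q m \<alpha> \<beta> \<subseteq> Rset"
  using M_ideal_ideal by (simp add: additive_subgroup.a_subset ideal.axioms(1))

text \<open>
  Modulo \<open>M\<^sub>\<alpha>\<^sub>,\<^sub>\<beta>\<close> every element of \<open>R\<close> is congruent to its value, because the generators are.
\<close>
lemma vanishing_in_M_ideal:
  assumes r: "r \<in> Rset" and \<beta>: "\<beta> \<noteq> 0" and z: "ev (\<alpha>, \<beta>) r = 0"
  shows "r \<in> M_ideal q m \<alpha> \<beta>"
proof -
  let ?e = "ev (\<alpha>, \<beta>)" and ?M = "M_ideal q m \<alpha> \<beta>" and ?s = "U_scalar q m"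
  interpret M: ideal ?M "R_alg q m" by (rule M_ideal_ideal)
  have x: "(\<alpha>, \<beta>) \<in> points" using \<beta> by simp
  have s: "?s (c + d) = ?s c \<oplus>\<^bsub>R_alg q m\<^esub> ?s d" "?s (c * d) = ?s c \<otimes>\<^bsub>R_alg q m\<^esub> ?s d" for c d
    by (simp_all add: U_scalar_def U_class_simps free_scalar_add free_scalar_mult)
  have s0: "?s 0 = \<zero>\<^bsub>R_alg q m\<^esub>"
    by (simp add: U_scalar_def U_class_simps)
  have gens: "xi q m \<ominus>\<^bsub>R_alg q m\<^esub> ?s \<alpha> \<in> ?M" "K_gen q m \<ominus>\<^bsub>R_alg q m\<^esub> ?s \<beta> \<in> ?M"
    using R.genideal_self[OF M_gens_in_R, of \<alpha> \<beta>] by (auto simp: M_ideal_def)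
  have "r \<ominus>\<^bsub>R_alg q m\<^esub> ?s (?e r) \<in> ?M"
    using r
  proof (induction rule: R_induct)
    case (scalar c)
    then show ?case using x M.zero_closed R.r_neg[of "?s c"] by (simp add: a_minus_def)
  next
    case Kinv
    \<comment> \<open>\<open>K\<^sup>-\<^sup>1 - \<beta>\<^sup>-\<^sup>1 = - \<beta>\<^sup>-\<^sup>1 K\<^sup>-\<^sup>1 (K - \<beta>)\<close>\<close>
    have "(?s (- inverse \<beta>) \<otimes>\<^bsub>R_alg q m\<^esub> Kinv_gen q m) \<otimes>\<^bsub>R_alg q m\<^esub> (K_gen q m \<ominus>\<^bsub>R_alg q m\<^esub> ?s \<beta>) \<in> ?M"
      by (rule M.I_l_closed[OF gens(2)]) (rule R.m_closed; simp)
    moreover have "(?s (- inverse \<beta>) \<otimes>\<^bsub>R_alg q m\<^esub> Kinv_gen q m) \<otimes>\<^bsub>R_alg q m\<^esub> (K_gen q m \<ominus>\<^bsub>R_alg q m\<^esub> ?s \<beta>)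
       = Kinv_gen q m \<ominus>\<^bsub>R_alg q m\<^esub> ?s (inverse \<beta>)"
    proof (rule eval_faithful)
      show "(?s (- inverse \<beta>) \<otimes>\<^bsub>R_alg q m\<^esub> Kinv_gen q m) \<otimes>\<^bsub>R_alg q m\<^esub> (K_gen q m \<ominus>\<^bsub>R_alg q m\<^esub> ?s \<beta>) \<in> Rset"
        by (intro R.m_closed R.minus_closed) auto
      show "Kinv_gen q m \<ominus>\<^bsub>R_alg q m\<^esub> ?s (inverse \<beta>) \<in> Rset" by simp
    next
      fix y :: "complex \<times> complex" assume y: "y \<in> points"
      have "?s (- inverse \<beta>) \<otimes>\<^bsub>U_alg q m\<^esub> Kinv_gen q m \<in> Rset" by (auto intro: R_closed)
      then show "ev y ((?s (- inverse \<beta>) \<otimes>\<^bsub>R_alg q m\<^esub> Kinv_gen q m) \<otimes>\<^bsub>R_alg q m\<^esub> (K_gen q m \<ominus>\<^bsub>R_alg q m\<^esub> ?s \<beta>)) =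
        ev y (Kinv_gen q m \<ominus>\<^bsub>R_alg q m\<^esub> ?s (inverse \<beta>))"
        using y \<beta> by (simp add: field_simps)
    qed
    ultimately show ?case using x by simp
  next
    case (add u v)
    have "(u \<oplus>\<^bsub>R_alg q m\<^esub> v) \<ominus>\<^bsub>R_alg q m\<^esub> ?s (?e u + ?e v) =
      (u \<ominus>\<^bsub>R_alg q m\<^esub> ?s (?e u)) \<oplus>\<^bsub>R_alg q m\<^esub> (v \<ominus>\<^bsub>R_alg q m\<^esub> ?s (?e v))"
      unfolding s by (rule eval_faithful) (use add(1,2) in \<open>simp_all add: R_closed\<close>)
    then show ?case using add x M.a_closed[OF add(3,4)] by simp
  next
    case (mult u v)
    have "(u \<otimes>\<^bsub>R_alg q m\<^esub> v) \<ominus>\<^bsub>R_alg q m\<^esub> ?s (?e u * ?e v) =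
      ((u \<ominus>\<^bsub>R_alg q m\<^esub> ?s (?e u)) \<otimes>\<^bsub>R_alg q m\<^esub> v) \<oplus>\<^bsub>R_alg q m\<^esub>
       (?s (?e u) \<otimes>\<^bsub>R_alg q m\<^esub> (v \<ominus>\<^bsub>R_alg q m\<^esub> ?s (?e v)))"
      unfolding s
      by (rule eval_faithful) (use mult(1,2) in \<open>simp_all add: R_closed algebra_simps\<close>)
    moreover have "((u \<ominus>\<^bsub>R_alg q m\<^esub> ?s (?e u)) \<otimes>\<^bsub>R_alg q m\<^esub> v) \<oplus>\<^bsub>R_alg q m\<^esub>
       (?s (?e u) \<otimes>\<^bsub>R_alg q m\<^esub> (v \<ominus>\<^bsub>R_alg q m\<^esub> ?s (?e v))) \<in> ?M"
      using mult by (intro M.a_closed M.I_l_closed M.I_r_closed) auto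
    ultimately show ?case using mult x by simp
  qed (use gens x in auto)
  moreover have "r \<ominus>\<^bsub>R_alg q m\<^esub> ?s (?e r) = r"
    unfolding z s0 using r R.minus_zero by (simp add: a_minus_def del: R_alg_simps)
  ultimately show ?thesis by simp
qed

end

section \<open>Cyclic modules spanned by the powers of one generator\<close>

text \<open>
  The common setting of the three parts. The generator of the module \<open>U/L\<close> is an eigenvector of \<open>K\<close> that
  \<open>Y\<close> annihilates, and \<open>X\<close> multiplies eigenvalues of \<open>K\<close> by \<open>p\<close>. The sign \<open>\<epsilon>\<close> accounts for
  \<open>FE - EF = -f(K)\<close>. The last assumption says that a power of \<open>X\<close> is in \<open>L\<close> whenever
  \<open>Y\<close> would annihilate it modulo \<open>L\<close>, which excludes a second vector of the kind of the generator.
\<close>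
locale cyclic_quotient = generic_q q m + left_ideal L "U_alg q m"
  for q m and L :: "free_elem set set" +
  fixes gX gY :: gen and p \<beta> \<epsilon> :: complex
  assumes gens: "{gX, gY} = {GenE, GenF}"
    and p_nz: "p \<noteq> 0" and \<beta>_nz: "\<beta> \<noteq> 0"
    and KX: "lK * letter gX - free_scalar p * letter gX * lK \<in> U_ideal q m"
    and YX: "letter gY * letter gX - letter gX * letter gY
       - free_scalar (\<epsilon> / (q - inverse q)) * (lK ^ m - lK' ^ m) \<in> U_ideal q m"
    and Y_L: "U_class q m (letter gY) \<in> L"
    and K_L: "U_class q m (lK - free_scalar \<beta>) \<in> L"
    and one_L: "U_class q m 1 \<notin> L"
    and cut: "\<epsilon> * (\<Sum>i<Suc k. f_val q m (p ^ i * \<beta>)) = 0 \<Longrightarrow> U_class q m (letter gX ^ Suc k) \<in> L"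
begin

definition \<tau> :: "nat \<Rightarrow> complex" where
  "\<tau> k = \<epsilon> * (\<Sum>i<k. f_val q m (p ^ i * \<beta>))"

abbreviation "lX \<equiv> letter gX"
abbreviation "lY \<equiv> letter gY"

text \<open>
  Computations take place in the free algebra, modulo the preimage of \<open>L\<close>. This relation is compatible
  with multiplication on the left only; relations of \<open>U\<close> may also be multiplied on the right
  (\<open>eqv_relation\<close>), because they lie in a two-sided ideal.
\<close>
definition eqv :: "free_elem \<Rightarrow> free_elem \<Rightarrow> bool" (infix "\<approx>" 50) where
  "u \<approx> v \<longleftrightarrow> U_class q m (u - v) \<in> L"

lemma L_zero: "U_class q m 0 \<in> L"
  using additive_subgroup.zero_closed[OF additive_subgroup_axioms] by (simp add: U_class_zero)

lemma L_add: "U_class q m u \<in> L \<Longrightarrow> U_class q m v \<in> L \<Longrightarrow> U_class q m (u + v) \<in> L"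
  using a_closed by (simp flip: U_class_add)

lemma L_mult: "U_class q m v \<in> L \<Longrightarrow> U_class q m (u * v) \<in> L"
  using absorb by (simp flip: U_class_mult)

lemma L_ideal: "u \<in> U_ideal q m \<Longrightarrow> U_class q m u \<in> L"
  using U_class_eq_iff[of q m u 0] L_zero by simp

lemma eqv_refl [simp]: "u \<approx> u"
  by (simp add: eqv_def L_zero)

lemma eqv_sym: "u \<approx> v \<Longrightarrow> v \<approx> u"
  using L_mult[of "u - v" "-1"] by (simp add: eqv_def)

lemma eqv_trans [trans]: "u \<approx> v \<Longrightarrow> v \<approx> w \<Longrightarrow> u \<approx> w"
  using L_add[of "u - v" "v - w"] by (simp add: eqv_def)

lemma eqv_add: "u \<approx> u' \<Longrightarrow> v \<approx> v' \<Longrightarrow> u + v \<approx> u' + v'"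
  using L_add[of "u - u'" "v - v'"] by (simp add: eqv_def add_diff_add)

lemma eqv_diff: "u \<approx> u' \<Longrightarrow> v \<approx> v' \<Longrightarrow> u - v \<approx> u' - v'"
  using eqv_add[of u u' "- v" "- v'"] eqv_sym[of v v'] by (simp add: eqv_def algebra_simps)

lemma eqv_mult: "u \<approx> v \<Longrightarrow> w * u \<approx> w * v"
  using L_mult[of "u - v" w] by (simp add: eqv_def right_diff_distrib)

lemma eqv_sum: "(\<And>k. k \<in> A \<Longrightarrow> u k \<approx> v k) \<Longrightarrow> sum u A \<approx> sum v A"
  by (induction A rule: infinite_finite_induct) (auto intro: eqv_add)

lemma eqv_relation: "u - v \<in> U_ideal q m \<Longrightarrow> u * w \<approx> v * w"
  using L_ideal[OF U_ideal_mult_right[of "u - v" q m w]] by (simp add: eqv_def left_diff_distrib)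

lemma eqv_eigen_power:
  assumes "z * v \<approx> free_scalar c * v"
  shows "z ^ n * v \<approx> free_scalar (c ^ n) * v"
proof (induction n)
  case (Suc n)
  have "z ^ Suc n * v = z * (z ^ n * v)" by (simp add: mult.assoc)
  also have "\<dots> \<approx> z * (free_scalar (c ^ n) * v)" by (rule eqv_mult[OF Suc])
  also have "\<dots> = free_scalar (c ^ n) * (z * v)" by (rule free_scalar_left_commute)
  also have "\<dots> \<approx> free_scalar (c ^ n) * (free_scalar c * v)" by (rule eqv_mult[OF assms])
  also have "\<dots> = free_scalar (c ^ Suc n) * v"
    by (simp add: free_scalar_left_assoc mult.commute)
  finally show ?case .
qed simp

lemma K_power: "lK * lX ^ k \<approx> free_scalar (p ^ k * \<beta>) * lX ^ k"
proof (induction k)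
  case 0
  then show ?case using K_L by (simp add: eqv_def)
next
  case (Suc k)
  have "lK * lX ^ Suc k = (lK * lX) * lX ^ k" by (simp add: mult.assoc)
  also have "\<dots> \<approx> (free_scalar p * lX * lK) * lX ^ k" by (rule eqv_relation[OF KX])
  also have "\<dots> = (free_scalar p * lX) * (lK * lX ^ k)" by (simp add: mult.assoc)
  also have "\<dots> \<approx> (free_scalar p * lX) * (free_scalar (p ^ k * \<beta>) * lX ^ k)"
    by (rule eqv_mult[OF Suc])
  also have "\<dots> = free_scalar (p ^ k * \<beta>) * (free_scalar p * lX ^ Suc k)"
    by (simp only: free_scalar_left_commute[of "free_scalar p * lX"]) (simp add: mult.assoc)
  also have "\<dots> = free_scalar (p ^ Suc k * \<beta>) * lX ^ Suc k"
    by (simp add: free_scalar_left_assoc ac_simps)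
  finally show ?case .
qed

lemma Kinv_power: "lK' * lX ^ k \<approx> free_scalar (inverse (p ^ k * \<beta>)) * lX ^ k"
proof -
  let ?c = "p ^ k * \<beta>"
  have c: "inverse ?c * ?c = 1" using p_nz \<beta>_nz by (intro left_inverse) simp
  have "lK' * lX ^ k = free_scalar (inverse ?c) * (lK' * (free_scalar ?c * lX ^ k))"
    by (simp only: free_scalar_left_commute[of lK'] free_scalar_left_assoc c) simp
  also have "\<dots> \<approx> free_scalar (inverse ?c) * (lK' * (lK * lX ^ k))"
    by (intro eqv_mult eqv_sym[OF K_power])
  also have "\<dots> = free_scalar (inverse ?c) * ((lK' * lK) * lX ^ k)" by (simp add: mult.assoc)
  also have "\<dots> \<approx> free_scalar (inverse ?c) * (1 * lX ^ k)"
    by (intro eqv_mult eqv_relation U_ideal_relations)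
  finally show ?thesis by simp
qed

lemma \<tau>_Suc: "\<tau> (Suc k) = \<tau> k + \<epsilon> * f_val q m (p ^ k * \<beta>)"
  by (simp add: \<tau>_def distrib_left)

text \<open>
  Moving \<open>Y\<close> past one factor \<open>X\<close> costs \<open>\<epsilon> f(K)\<close>, and \<open>X ^ k\<close> is an eigenvector of \<open>K\<close>.
\<close>
lemma Y_power_step:
  "lY * lX ^ Suc k \<approx> lX * (lY * lX ^ k) + free_scalar (\<epsilon> * f_val q m (p ^ k * \<beta>)) * lX ^ k"
proof -
  let ?e = "\<epsilon> / (q - inverse q)" and ?c = "p ^ k * \<beta>"
  let ?H = "free_scalar ?e * (lK ^ m - lK' ^ m)"
  have "lY * lX ^ Suc k = (lY * lX) * lX ^ k" by (simp add: mult.assoc)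
  also have "\<dots> \<approx> (lX * lY + ?H) * lX ^ k"
    using YX by (intro eqv_relation) (simp add: diff_diff_eq)
  also have "\<dots> = lX * (lY * lX ^ k) + free_scalar ?e * (lK ^ m * lX ^ k - lK' ^ m * lX ^ k)"
    by (simp add: distrib_right left_diff_distrib mult.assoc)
  also have "\<dots> \<approx> lX * (lY * lX ^ k) +
      free_scalar ?e * (free_scalar (?c ^ m) * lX ^ k - free_scalar (inverse ?c ^ m) * lX ^ k)"
    by (intro eqv_add eqv_mult eqv_diff eqv_eigen_power K_power Kinv_power eqv_refl)
  also have "free_scalar ?e * (free_scalar (?c ^ m) * lX ^ k - free_scalar (inverse ?c ^ m) * lX ^ k) =
      free_scalar ?e * (free_scalar (?c ^ m - inverse ?c ^ m) * lX ^ k)"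
    by (simp add: free_scalar_diff left_diff_distrib)
  also have "\<dots> = free_scalar (\<epsilon> * f_val q m ?c) * lX ^ k"
    by (simp add: free_scalar_left_assoc f_val_def)
  finally show ?thesis .
qed

lemma Y_power_0: "lY * lX ^ 0 \<approx> 0"
  using Y_L by (simp add: eqv_def)

lemma Y_power_Suc: "lY * lX ^ Suc k \<approx> free_scalar (\<tau> (Suc k)) * lX ^ k"
proof -
  have "lX * (lY * lX ^ k) \<approx> free_scalar (\<tau> k) * lX ^ k"
  proof (induction k)
    case 0
    then show ?case using eqv_mult[OF Y_power_0, of lX] by (simp add: \<tau>_def)
  next
    case (Suc k)
    have "lX * (lY * lX ^ Suc k) \<approx> lX * (lX * (lY * lX ^ k) + free_scalar (\<epsilon> * f_val q m (p ^ k * \<beta>)) * lX ^ k)"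
      by (intro eqv_mult Y_power_step)
    also have "\<dots> \<approx> lX * (free_scalar (\<tau> k) * lX ^ k + free_scalar (\<epsilon> * f_val q m (p ^ k * \<beta>)) * lX ^ k)"
      by (intro eqv_mult eqv_add Suc eqv_refl)
    also have "\<dots> = lX * (free_scalar (\<tau> (Suc k)) * lX ^ k)"
      by (simp add: \<tau>_Suc free_scalar_add distrib_right)
    finally show ?case by (simp add: free_scalar_left_commute)
  qed
  then have "lX * (lY * lX ^ k) + free_scalar (\<epsilon> * f_val q m (p ^ k * \<beta>)) * lX ^ k \<approx>
      free_scalar (\<tau> k) * lX ^ k + free_scalar (\<epsilon> * f_val q m (p ^ k * \<beta>)) * lX ^ k"
    by (intro eqv_add eqv_refl)
  with Y_power_step have "lY * lX ^ Suc k \<approx>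
      free_scalar (\<tau> k) * lX ^ k + free_scalar (\<epsilon> * f_val q m (p ^ k * \<beta>)) * lX ^ k"
    by (rule eqv_trans)
  then show ?thesis by (simp add: \<tau>_Suc free_scalar_add distrib_right)
qed

text \<open>
  The combinations of powers of \<open>X\<close> contain \<open>1\<close> and are stable under all four letters, up to \<open>L\<close>.
\<close>
lemma spanning: "\<exists>P. u \<approx> poly_at lX P"
proof -
  let ?W = "\<lambda>u. \<exists>P. u \<approx> poly_at lX P"
  have W_monom: "?W v" if "v \<approx> free_scalar c * lX ^ k" for v c k
    using that by (auto simp flip: poly_at_monom)
  have W_add: "?W (u + v)" if "?W u" "?W v" for u v
    using that eqv_add by (metis poly_at_add)
  have W_eqv: "?W u" if "u \<approx> v" "?W v" for u v
    using that eqv_trans by blast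
  have Y_monom: "?W (lY * lX ^ k)" for k
    using W_monom[of "lY * lX ^ k" 0 0] Y_power_0 W_monom[OF Y_power_Suc] by (cases k) auto
  have X_monom: "?W (lX * lX ^ k)" for k
    using W_monom[of "lX * lX ^ k" 1 "Suc k"] by simp
  have letter_monom: "?W (letter g * lX ^ k)" for g k
  proof -
    have "g = gX \<or> g = gY \<or> g = GenK \<or> g = GenKinv"
      using gens by (cases g) auto
    then show ?thesis
      using X_monom[of k] Y_monom[of k] W_monom[OF K_power[of k]] W_monom[OF Kinv_power[of k]] by auto
  qed
  have W_smult: "?W (free_scalar c * u)" if "?W u" for c u
    using that eqv_mult by (metis poly_at_smult)
  have letter_poly: "?W (letter g * poly_at lX P)" for g P
  proof (rule poly_at_closure)
    show "?W (letter g * 0)" by (auto intro: exI[of _ 0])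
    show "?W (letter g * (u + v))" if "?W (letter g * u)" "?W (letter g * v)" for u v
      using W_add[OF that] by (simp add: distrib_left)
    show "?W (letter g * (free_scalar c * lX ^ k))" for c k
      unfolding free_scalar_left_commute by (rule W_smult[OF letter_monom])
  qed
  show ?thesis
  proof (induction u rule: free_elem_letter_induct)
    case scalar
    show ?case using W_monom[of 1 1 0] by simp
  next
    case (letter g u)
    then obtain P where "u \<approx> poly_at lX P" by blast
    then show ?case using W_eqv[OF eqv_mult letter_poly] by blast
  qed (use W_add W_smult in blast)+
qed

text \<open>
  Modulo \<open>L\<close>, multiplication by \<open>Y\<close> is a weighted derivative of polynomials in \<open>X\<close>.
\<close>
lemma lower_degree:
  "\<exists>Q. lY * poly_at lX P \<approx> poly_at lX Q \<and> (\<forall>k. Polynomial.coeff Q k = \<tau> (Suc k) * Polynomial.coeff P (Suc k))"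
proof (intro exI conjI allI)
  define Q where "Q = (\<Sum>k<Polynomial.degree P. Polynomial.monom (\<tau> (Suc k) * Polynomial.coeff P (Suc k)) k)"
  have "lY * poly_at lX P = (\<Sum>k\<le>Polynomial.degree P. free_scalar (Polynomial.coeff P k) * (lY * lX ^ k))"
    by (simp only: poly_at_altdef sum_distrib_left free_scalar_left_commute)
  also have "\<dots> = free_scalar (Polynomial.coeff P 0) * (lY * lX ^ 0) +
      (\<Sum>k<Polynomial.degree P. free_scalar (Polynomial.coeff P (Suc k)) * (lY * lX ^ Suc k))"
    by (rule sum.atMost_shift)
  also have "\<dots> \<approx> free_scalar (Polynomial.coeff P 0) * 0 +
      (\<Sum>k<Polynomial.degree P. free_scalar (Polynomial.coeff P (Suc k)) * (free_scalar (\<tau> (Suc k)) * lX ^ k))"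
    by (intro eqv_add eqv_sum eqv_mult Y_power_0 Y_power_Suc)
  also have "\<dots> = poly_at lX Q"
    by (simp add: Q_def poly_at_sum poly_at_monom free_scalar_left_assoc mult.commute)
  finally show "lY * poly_at lX P \<approx> poly_at lX Q" .
  show "Polynomial.coeff Q k = \<tau> (Suc k) * Polynomial.coeff P (Suc k)" for k
    by (cases "k < Polynomial.degree P") (auto simp: Q_def coeff_sum coeff_eq_0 if_distrib sum.delta cong: if_cong)
qed

text \<open>
  Each application of \<open>Y\<close> lowers the degree by exactly one, as long as the weights do not vanish. The last
  polynomial is a nonzero constant.
\<close>
lemma reach_one:
  assumes J: "left_ideal J (U_alg q m)" "L \<subseteq> J"
    and "U_class q m (poly_at lX P) \<in> J" "P \<noteq> 0" "\<And>j. j < Polynomial.degree P \<Longrightarrow> \<tau> (Suc j) \<noteq> 0"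
  shows "U_class q m 1 \<in> J"
  using assms(3-)
proof (induction "Polynomial.degree P" arbitrary: P)
  case 0
  interpret J: left_ideal J "U_alg q m" by (rule J)
  obtain c where c: "P = [:c:]" using 0(1) by (metis degree_eq_zeroE)
  then have "c \<noteq> 0" using 0 by simp
  then have "free_scalar (inverse c) * free_scalar c = 1" by (simp flip: free_scalar_mult)
  moreover have "U_class q m (free_scalar (inverse c)) \<otimes>\<^bsub>U_alg q m\<^esub> U_class q m (poly_at lX P) \<in> J"
    by (rule J.absorb) (use 0 in simp_all)
  ultimately show ?case by (simp add: U_class_mult c)
next
  case (Suc d)
  interpret J: left_ideal J "U_alg q m" by (rule J)
  obtain Q where Q: "lY * poly_at lX P \<approx> poly_at lX Q" "\<And>k. Polynomial.coeff Q k = \<tau> (Suc k) * Polynomial.coeff P (Suc k)"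
    using lower_degree by blast
  have "Polynomial.coeff P (Suc d) \<noteq> 0" using Suc.hyps(2) Suc.prems(2) by (metis leading_coeff_0_iff)
  then have lead: "Polynomial.coeff Q d \<noteq> 0"
    using Suc.hyps(2) Suc.prems(3)[of d] by (simp add: Q)
  have high: "Polynomial.coeff Q k = 0" if "k > d" for k
    using that Suc.hyps(2) by (simp add: Q coeff_eq_0)
  have "Polynomial.degree Q \<le> d" by (rule degree_le) (use high in blast)
  then have deg: "Polynomial.degree Q = d" using le_degree[OF lead] by (rule antisym)
  have Q_nz: "Q \<noteq> 0" using lead by auto
  have "U_class q m (lY * poly_at lX P) \<in> J"
    using J.absorb[OF _ Suc.prems(1), of "U_class q m lY"] by (simp add: U_class_mult)
  moreover have "U_class q m (poly_at lX Q - lY * poly_at lX P) \<in> J"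
    using eqv_sym[OF Q(1)] J(2) by (auto simp: eqv_def)
  ultimately have "U_class q m (poly_at lX Q) \<in> J"
    using J.a_closed by (fastforce simp: U_class_add)
  then show ?case
    using deg Q_nz Suc.hyps(2) Suc.prems(3) by (intro Suc.hyps(1)[of Q]) simp_all
qed

text \<open>
  A vanishing \<open>\<tau> (Suc j)\<close> with \<open>j\<close> below the degree puts \<open>X ^ Suc j\<close>, hence also the leading term, into \<open>L\<close>.
  So the leading term can be dropped.
\<close>
lemma reduced_representative:
  assumes "U_class q m u \<notin> L"
  obtains P where "u \<approx> poly_at lX P" "P \<noteq> 0" "\<And>j. j < Polynomial.degree P \<Longrightarrow> \<tau> (Suc j) \<noteq> 0"
proof -
  have "\<exists>P'. u \<approx> poly_at lX P' \<and> P' \<noteq> 0 \<and> (\<forall>j<Polynomial.degree P'. \<tau> (Suc j) \<noteq> 0)" if "u \<approx> poly_at lX P" for P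
    using that
  proof (induction "Polynomial.degree P" arbitrary: P rule: less_induct)
    case less
    have nz: "P \<noteq> 0" using less.prems assms by (auto simp: eqv_def)
    show ?case
    proof (cases "\<exists>j<Polynomial.degree P. \<tau> (Suc j) = 0")
      case False
      then show ?thesis using less.prems nz by blast
    next
      case True
      then obtain j where j: "j < Polynomial.degree P" "\<tau> (Suc j) = 0" by blast
      let ?d = "Polynomial.degree P"
      define Q where "Q = P - Polynomial.monom (lead_coeff P) ?d"
      have "U_class q m (lX ^ Suc j) \<in> L" using cut j(2) by (simp add: \<tau>_def)
      then have "U_class q m (lX ^ (?d - Suc j) * lX ^ Suc j) \<in> L" by (rule L_mult)
      moreover have "lX ^ (?d - Suc j) * lX ^ Suc j = lX ^ ?d"
        using j(1) by (subst power_add[symmetric]) simp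
      ultimately have "U_class q m (free_scalar (lead_coeff P) * lX ^ ?d) \<in> L"
        by (intro L_mult) simp
      then have "poly_at lX P \<approx> poly_at lX Q"
        by (simp add: eqv_def Q_def poly_at_diff poly_at_monom)
      then have uQ: "u \<approx> poly_at lX Q" using less.prems eqv_trans by blast
      have "Polynomial.degree Q \<le> ?d"
        unfolding Q_def by (intro degree_diff_le) (simp_all add: degree_monom_le)
      moreover have "Polynomial.degree Q \<noteq> ?d"
      proof
        assume eq: "Polynomial.degree Q = ?d"
        have "Polynomial.coeff Q ?d = 0" by (simp add: Q_def)
        then have "Q = 0" using eq by (metis leading_coeff_0_iff)
        then show False using eq j(1) by simp
      qed
      ultimately show ?thesis using less.hyps[OF _ uQ] by simp
    qed
  qed
  then show ?thesis using spanning[of u] that by blast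
qed

lemma irreducible: "irreducible_module (U_alg q m) (quot_module (U_alg q m) L)"
proof (rule irreducible_quot_module)
  show "\<one>\<^bsub>U_alg q m\<^esub> \<notin> L" using one_L by (simp add: U_class_one)
  fix J assume J: "left_ideal J (U_alg q m)" "L \<subseteq> J" "J \<noteq> L"
  interpret J: left_ideal J "U_alg q m" by (rule J)
  obtain w where w: "w \<in> J" "w \<notin> L" using J by blast
  then obtain u where u: "w = U_class q m u" by (metis J.a_Hcarr U_class_surj)
  obtain P where P: "u \<approx> poly_at lX P" "P \<noteq> 0" "\<And>j. j < Polynomial.degree P \<Longrightarrow> \<tau> (Suc j) \<noteq> 0"
    using reduced_representative w u by blast
  have "U_class q m (poly_at lX P - u) \<in> J" using eqv_sym[OF P(1)] J by (auto simp: eqv_def)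
  then have "U_class q m (poly_at lX P) \<in> J"
    using J.a_closed[OF _ w(1)] by (fastforce simp: u U_class_add)
  then show "\<one>\<^bsub>U_alg q m\<^esub> \<in> J"
    using reach_one[OF J(1,2)] P by (simp add: U_class_one)
qed

abbreviation "UL \<equiv> quot_module (U_alg q m) L"

definition coset :: "free_elem \<Rightarrow> free_elem set set" where
  "coset u = L +>\<^bsub>U_alg q m\<^esub> U_class q m u"

lemma coset_simps:
  "coset u \<oplus>\<^bsub>UL\<^esub> coset v = coset (u + v)"
  "U_scalar q m c \<odot>\<^bsub>UL\<^esub> coset u = coset (free_scalar c * u)"
  "\<zero>\<^bsub>UL\<^esub> = coset 0"
  "coset u = coset v \<longleftrightarrow> u \<approx> v"
  "coset u \<in> carrier UL"
  using coset_eq_self_iff[of "U_class q m 0"] L_zero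
  by (simp_all add: coset_def quot_add quot_smult quot_zero U_class_add U_class_mult U_scalar_def
      coset_eq_iff U_class_diff eqv_def coset_in_quot)

lemma quotient_elem:
  assumes "x \<in> carrier UL"
  obtains P where "x = coset (poly_at lX P)"
proof -
  obtain u where u: "u \<in> carrier (U_alg q m)" "x = L +>\<^bsub>U_alg q m\<^esub> u"
    using assms by (auto simp: quot_carrier)
  obtain r where "u = U_class q m r" using u(1) by (rule U_class_surj)
  then have "x = coset r" by (simp add: coset_def u)
  moreover obtain P where "r \<approx> poly_at lX P" using spanning by blast
  ultimately show ?thesis using that by (simp add: coset_simps)
qed

text \<open>
  Finitely many vectors involve powers of \<open>X\<close> of bounded degree. If they spanned, some \<open>X ^ d\<close> would be
  congruent to a polynomial of smaller degree, and lowering the difference to a constant would put \<open>1\<close>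
  into \<open>L\<close>.
\<close>
lemma infinite_dim:
  assumes "\<And>k. \<tau> (Suc k) \<noteq> 0"
  shows "\<not> finite_dim_module (U_scalar q m) UL"
proof
  interpret M: left_module "U_alg q m" UL by (rule quot_left_module)
  assume "finite_dim_module (U_scalar q m) UL"
  then obtain B where B: "finite B" "B \<subseteq> carrier UL"
    and span: "\<And>x. x \<in> carrier UL \<Longrightarrow>
        \<exists>c. x = (\<Oplus>\<^bsub>UL\<^esub>b\<in>B. U_scalar q m (c b) \<odot>\<^bsub>UL\<^esub> b)"
    unfolding finite_dim_module_def by blast
  have "\<exists>P. \<forall>b\<in>B. b = coset (poly_at lX (P b))"
    by (rule bchoice) (use B quotient_elem in blast)
  then obtain P where P: "\<And>b. b \<in> B \<Longrightarrow> b = coset (poly_at lX (P b))" by blast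
  define d where "d = Suc (\<Sum>b\<in>B. Polynomial.degree (P b))"
  have deg: "Polynomial.degree (P b) < d" if "b \<in> B" for b
    using member_le_sum[of b B "\<lambda>b. Polynomial.degree (P b)"] that B by (simp add: d_def)
  obtain c where c: "coset (lX ^ d) = (\<Oplus>\<^bsub>UL\<^esub>b\<in>B. U_scalar q m (c b) \<odot>\<^bsub>UL\<^esub> b)"
    using span[of "coset (lX ^ d)"] by (auto simp: coset_simps)
  have closed: "U_scalar q m (c b) \<odot>\<^bsub>UL\<^esub> b \<in> carrier UL" if "b \<in> B" for b
    using that B by (intro M.smult_closed) auto
  have "\<exists>Q. Polynomial.degree Q < d \<and> (\<Oplus>\<^bsub>UL\<^esub>b\<in>A. U_scalar q m (c b) \<odot>\<^bsub>UL\<^esub> b) = coset (poly_at lX Q)"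
    if "finite A" "A \<subseteq> B" for A
    using that
  proof (induction A)
    case empty
    show ?case by (rule exI[of _ 0]) (simp add: coset_simps d_def)
  next
    case (insert b A)
    then obtain Q where Q: "Polynomial.degree Q < d"
      "(\<Oplus>\<^bsub>UL\<^esub>b\<in>A. U_scalar q m (c b) \<odot>\<^bsub>UL\<^esub> b) = coset (poly_at lX Q)" by blast
    have "(\<Oplus>\<^bsub>UL\<^esub>b\<in>insert b A. U_scalar q m (c b) \<odot>\<^bsub>UL\<^esub> b) =
        U_scalar q m (c b) \<odot>\<^bsub>UL\<^esub> b \<oplus>\<^bsub>UL\<^esub> coset (poly_at lX Q)"
      unfolding Q(2)[symmetric] by (rule M.finsum_insert) (use insert closed in auto)
    also have "\<dots> = U_scalar q m (c b) \<odot>\<^bsub>UL\<^esub> coset (poly_at lX (P b)) \<oplus>\<^bsub>UL\<^esub> coset (poly_at lX Q)"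
      using P[of b] insert by simp
    also have "\<dots> = coset (poly_at lX (smult (c b) (P b) + Q))"
      by (simp add: coset_simps(1,2) poly_at_add poly_at_smult)
    finally show ?case
      using Q(1) deg[of b] insert by (intro exI conjI) (auto intro!: degree_add_less)
  qed
  from this[OF B(1) subset_refl] obtain Q where Q: "Polynomial.degree Q < d" "coset (lX ^ d) = coset (poly_at lX Q)"
    using c by auto
  then have "poly_at lX (Polynomial.monom 1 d - Q) \<approx> 0"
    by (simp add: coset_simps poly_at_diff poly_at_monom eqv_def)
  then have "U_class q m (poly_at lX (Polynomial.monom 1 d - Q)) \<in> L" by (simp add: eqv_def)
  moreover have "Polynomial.monom 1 d - Q \<noteq> 0"
    using Q(1) by (metis coeff_eq_0 coeff_monom eq_iff_diff_eq_0 zero_neq_one)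
  ultimately show False
    using reach_one[OF left_ideal_axioms] assms one_L by blast
qed

lemma finite_dim:
  assumes "U_class q m (lX ^ n) \<in> L"
  shows "finite_dim_module (U_scalar q m) UL"
proof -
  interpret M: left_module "U_alg q m" UL by (rule quot_left_module)
  define B where "B = (\<lambda>k. coset (lX ^ k)) ` {..<n}"
  have B: "finite B" "B \<subseteq> carrier UL" by (auto simp: B_def coset_simps)
  define comb where "comb c = (\<Oplus>\<^bsub>UL\<^esub>b\<in>B. U_scalar q m (c b) \<odot>\<^bsub>UL\<^esub> b)" for c
  have closed: "(\<lambda>b. U_scalar q m (c b) \<odot>\<^bsub>UL\<^esub> b) \<in> B \<rightarrow> carrier UL" for c
    using B by (intro funcsetI M.smult_closed) auto
  have zero: "comb (\<lambda>_. 0) = coset 0"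
  proof -
    have "U_scalar q m 0 \<odot>\<^bsub>UL\<^esub> b = \<zero>\<^bsub>UL\<^esub>" if "b \<in> B" for b
      using that by (auto simp: B_def coset_simps)
    then have "comb (\<lambda>_. 0) = (\<Oplus>\<^bsub>UL\<^esub>b\<in>B. \<zero>\<^bsub>UL\<^esub>)"
      unfolding comb_def by (intro M.finsum_cong') auto
    then show ?thesis using M.finsum_zero[of B] by (simp add: coset_simps(3))
  qed
  have add: "comb c \<oplus>\<^bsub>UL\<^esub> comb d = comb (\<lambda>b. c b + d b)" for c d
  proof -
    have "comb c \<oplus>\<^bsub>UL\<^esub> comb d =
        (\<Oplus>\<^bsub>UL\<^esub>b\<in>B. U_scalar q m (c b) \<odot>\<^bsub>UL\<^esub> b \<oplus>\<^bsub>UL\<^esub> U_scalar q m (d b) \<odot>\<^bsub>UL\<^esub> b)"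
      unfolding comb_def by (rule M.finsum_addf[symmetric]) (rule closed)+
    also have "\<dots> = comb (\<lambda>b. c b + d b)"
      unfolding comb_def
    proof (rule M.finsum_cong'[OF refl closed])
      fix b assume "b \<in> B"
      then obtain k where "b = coset (lX ^ k)" by (auto simp: B_def)
      then show "U_scalar q m (c b) \<odot>\<^bsub>UL\<^esub> b \<oplus>\<^bsub>UL\<^esub> U_scalar q m (d b) \<odot>\<^bsub>UL\<^esub> b =
          U_scalar q m (c b + d b) \<odot>\<^bsub>UL\<^esub> b"
        by (simp add: coset_simps free_scalar_add distrib_right)
    qed
    finally show ?thesis .
  qed
  have monom: "\<exists>c. coset (free_scalar a * lX ^ k) = comb c" for a k
  proof (cases "k < n")
    case True
    let ?b = "coset (lX ^ k)"
    have b: "?b \<in> B" using True by (auto simp: B_def)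
    \<comment> \<open>Coefficients are indexed by cosets, so it does not matter whether the powers of \<open>X\<close> below \<open>n\<close> have distinct cosets.\<close>
    let ?c = "\<lambda>b. if b = ?b then a else 0"
    have "comb ?c = (\<Oplus>\<^bsub>UL\<^esub>b\<in>B. if ?b = b then U_scalar q m a \<odot>\<^bsub>UL\<^esub> b else \<zero>\<^bsub>UL\<^esub>)"
      unfolding comb_def
    proof (rule M.finsum_cong'[OF refl])
      show "(\<lambda>b. if ?b = b then U_scalar q m a \<odot>\<^bsub>UL\<^esub> b else \<zero>\<^bsub>UL\<^esub>) \<in> B \<rightarrow> carrier UL"
        using closed[of "\<lambda>_. a"] by (auto simp: Pi_iff)
      fix b' assume "b' \<in> B"
      then show "U_scalar q m (?c b') \<odot>\<^bsub>UL\<^esub> b' =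
          (if ?b = b' then U_scalar q m a \<odot>\<^bsub>UL\<^esub> b' else \<zero>\<^bsub>UL\<^esub>)"
        by (auto simp: B_def coset_simps)
    qed
    also have "\<dots> = U_scalar q m a \<odot>\<^bsub>UL\<^esub> ?b"
      by (rule M.finsum_singleton[OF b B(1)]) (rule closed)
    finally show ?thesis by (metis coset_simps(2))
  next
    case False
    then have "lX ^ k = lX ^ (k - n) * lX ^ n" by (simp flip: power_add)
    then have "U_class q m (lX ^ k) \<in> L" using L_mult[OF assms] by metis
    then have "coset (free_scalar a * lX ^ k) = coset 0"
      using L_mult by (simp add: coset_simps eqv_def)
    then show ?thesis using zero by metis
  qed
  have "\<exists>c. coset (poly_at lX P) = comb c" for P
  proof (rule poly_at_closure)
    show "\<exists>c. coset 0 = comb c" using zero by metis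
    show "\<exists>c. coset (u + v) = comb c" if "\<exists>c. coset u = comb c" "\<exists>c. coset v = comb c" for u v
      using that by (elim exE) (simp add: add flip: coset_simps(1), blast)
  qed (rule monom)
  then have "\<exists>c. x = comb c" if "x \<in> carrier UL" for x
    using quotient_elem[OF that] by blast
  then show ?thesis
    unfolding finite_dim_module_def comb_def using B by blast
qed

end

section \<open>The three families of left ideals\<close>

definition delta :: "int \<Rightarrow> int \<Rightarrow> complex" where
  "delta k j = (if j = k then 1 else 0)"

context weight_module
begin

interpretation U: ring "U_alg q m" by (rule U_alg_ring)
interpretation R: ring "R_alg q m" by (rule R_alg_ring)

text \<open>
  The elements of \<open>R\<close> whose eigenvalue at index \<open>0\<close> vanishes form an ideal of \<open>R\<close>, and it contains the two
  generators of \<open>M\<close>.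
\<close>
lemma M_ideal_kills_delta:
  assumes r: "r \<in> M_ideal q m (a 0 * b 0) (\<kappa> 0)"
  shows "uact r (delta 0) = (\<lambda>_. 0)"
proof -
  let ?N = "{r \<in> carrier (R_alg q m). wt r 0 = 0}"
  have "ideal ?N (R_alg q m)"
  proof (rule idealI)
    show "ring (R_alg q m)" by (rule R_alg_ring)
    show "subgroup ?N (add_monoid (R_alg q m))"
    proof (rule R.add.subgroupI)
      show "?N \<noteq> {}" using R_gens_closed(3)[of q m 0] wt_gens(1)[of 0 0] by blast
      show "\<ominus>\<^bsub>R_alg q m\<^esub> u \<in> ?N" if "u \<in> ?N" for u
        using that R.a_inv_closed[of u]
        by (simp add: R_uminus) (simp add: wt_def uact_uminus R_in_U)
    qed (auto simp: wt_add R_closed)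
  qed (auto simp: wt_mult R_closed)
  moreover have "{xi q m \<ominus>\<^bsub>R_alg q m\<^esub> U_scalar q m (a 0 * b 0),
      K_gen q m \<ominus>\<^bsub>R_alg q m\<^esub> U_scalar q m (\<kappa> 0)} \<subseteq> ?N"
    by (simp add: wt_minus)
  ultimately have "M_ideal q m (a 0 * b 0) (\<kappa> 0) \<subseteq> ?N"
    unfolding M_ideal_def by (rule R.genideal_minimal)
  then have "r \<in> carrier (R_alg q m)" "wt r 0 = 0" using r by auto
  then show ?thesis by (auto simp: uact_R delta_def)
qed

end

context generic_q
begin

interpretation U: ring "U_alg q m" by (rule U_alg_ring)
interpretation R: ring "R_alg q m" by (rule R_alg_ring)

lemma M_ideal_facts:
  shows "M_ideal q m \<alpha> \<beta> \<subseteq> carrier (U_alg q m)"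
    and "U_class q m (lK - free_scalar \<beta>) \<in> M_ideal q m \<alpha> \<beta>"
proof -
  show "M_ideal q m \<alpha> \<beta> \<subseteq> carrier (U_alg q m)"
    using M_ideal_subset R_in_U by blast
  have "K_gen q m \<ominus>\<^bsub>R_alg q m\<^esub> U_scalar q m \<beta> \<in> M_ideal q m \<alpha> \<beta>"
    using R.genideal_self[OF M_gens_in_R, of \<alpha> \<beta>] by (auto simp: M_ideal_def)
  then show "U_class q m (lK - free_scalar \<beta>) \<in> M_ideal q m \<alpha> \<beta>"
    by (simp add: a_minus_def[of "R_alg q m"] R_uminus)
      (simp add: U_gen_defs U_class_simps)
qed

lemma P_1_inf_left_ideal:
  "left_ideal (P_1_inf q m (M_ideal q m \<alpha> \<beta>)) (U_alg q m)"
  "M_ideal q m \<alpha> \<beta> \<subseteq> P_1_inf q m (M_ideal q m \<alpha> \<beta>)"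
  "E_gen q m \<in> P_1_inf q m (M_ideal q m \<alpha> \<beta>)"
  "left_ideal J (U_alg q m) \<Longrightarrow> M_ideal q m \<alpha> \<beta> \<subseteq> J \<Longrightarrow> E_gen q m \<in> J \<Longrightarrow>
     P_1_inf q m (M_ideal q m \<alpha> \<beta>) \<subseteq> J"
proof -
  let ?P = "M_ideal q m \<alpha> \<beta>" and ?U = "U_alg q m"
  note A = U.left_ideal_ideal_prod[OF M_ideal_facts(1,2)[where \<alpha> = \<alpha> and \<beta> = \<beta>]]
  have E: "E_gen q m \<in> carrier ?U" by simp
  note B = U.left_ideal_carrier_mult[OF E]
  show "left_ideal (P_1_inf q m ?P) ?U"
    unfolding P_1_inf_def Let_def by (rule U.left_ideal_set_add[OF A B])
  show "?P \<subseteq> P_1_inf q m ?P" "E_gen q m \<in> P_1_inf q m ?P"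
    using U.set_add_superset[OF A B] U.ideal_prod_carrier_superset[OF M_ideal_facts(1)[where \<alpha> = \<alpha> and \<beta> = \<beta>]]
      U.carrier_mult_self[OF E]
    unfolding P_1_inf_def Let_def by blast+
  show "P_1_inf q m ?P \<subseteq> J" if "left_ideal J ?U" "?P \<subseteq> J" "E_gen q m \<in> J"
    unfolding P_1_inf_def Let_def
    by (intro U.set_add_minimal U.ideal_prod_carrier_minimal U.carrier_mult_minimal that)
qed

lemma P_inf_1_left_ideal:
  "left_ideal (P_inf_1 q m (M_ideal q m \<alpha> \<beta>)) (U_alg q m)"
  "M_ideal q m \<alpha> \<beta> \<subseteq> P_inf_1 q m (M_ideal q m \<alpha> \<beta>)"
  "F_gen q m \<in> P_inf_1 q m (M_ideal q m \<alpha> \<beta>)"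
  "left_ideal J (U_alg q m) \<Longrightarrow> M_ideal q m \<alpha> \<beta> \<subseteq> J \<Longrightarrow> F_gen q m \<in> J \<Longrightarrow>
     P_inf_1 q m (M_ideal q m \<alpha> \<beta>) \<subseteq> J"
proof -
  let ?P = "M_ideal q m \<alpha> \<beta>" and ?U = "U_alg q m"
  note A = U.left_ideal_ideal_prod[OF M_ideal_facts(1,2)[where \<alpha> = \<alpha> and \<beta> = \<beta>]]
  have F: "F_gen q m \<in> carrier ?U" by simp
  note B = U.left_ideal_carrier_mult[OF F]
  show "left_ideal (P_inf_1 q m ?P) ?U"
    unfolding P_inf_1_def Let_def by (rule U.left_ideal_set_add[OF A B])
  show "?P \<subseteq> P_inf_1 q m ?P" "F_gen q m \<in> P_inf_1 q m ?P"
    using U.set_add_superset[OF A B] U.ideal_prod_carrier_superset[OF M_ideal_facts(1)[where \<alpha> = \<alpha> and \<beta> = \<beta>]]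
      U.carrier_mult_self[OF F]
    unfolding P_inf_1_def Let_def by blast+
  show "P_inf_1 q m ?P \<subseteq> J" if "left_ideal J ?U" "?P \<subseteq> J" "F_gen q m \<in> J"
    unfolding P_inf_1_def Let_def
    by (intro U.set_add_minimal U.ideal_prod_carrier_minimal U.carrier_mult_minimal that)
qed

lemma P_1_fin_left_ideal:
  fixes k :: nat
  shows "left_ideal (P_1_fin q m (M_ideal q m \<alpha> \<beta>) k) (U_alg q m)"
    "P_1_inf q m (M_ideal q m \<alpha> \<beta>) \<subseteq> P_1_fin q m (M_ideal q m \<alpha> \<beta>) k"
    "F_gen q m [^]\<^bsub>U_alg q m\<^esub> k \<in> P_1_fin q m (M_ideal q m \<alpha> \<beta>) k"
    "left_ideal J (U_alg q m) \<Longrightarrow> P_1_inf q m (M_ideal q m \<alpha> \<beta>) \<subseteq> J \<Longrightarrow>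
       F_gen q m [^]\<^bsub>U_alg q m\<^esub> k \<in> J \<Longrightarrow> P_1_fin q m (M_ideal q m \<alpha> \<beta>) k \<subseteq> J"
proof -
  let ?P = "M_ideal q m \<alpha> \<beta>" and ?U = "U_alg q m"
  have eq: "P_1_fin q m ?P k = set_add ?U (P_1_inf q m ?P) (carrier ?U #>\<^bsub>?U\<^esub> (F_gen q m [^]\<^bsub>?U\<^esub> k))"
    by (simp add: P_1_fin_def P_1_inf_def Let_def)
  note A = P_1_inf_left_ideal(1)[of \<alpha> \<beta>]
  have F: "F_gen q m [^]\<^bsub>?U\<^esub> k \<in> carrier ?U" by simp
  note B = U.left_ideal_carrier_mult[OF F]
  show "left_ideal (P_1_fin q m ?P k) ?U"
    unfolding eq by (rule U.left_ideal_set_add[OF A B])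
  show "P_1_inf q m ?P \<subseteq> P_1_fin q m ?P k" "F_gen q m [^]\<^bsub>?U\<^esub> k \<in> P_1_fin q m ?P k"
    using U.set_add_superset[OF A B] U.carrier_mult_self[OF F] unfolding eq by blast+
  show "P_1_fin q m ?P k \<subseteq> J" if "left_ideal J ?U" "P_1_inf q m ?P \<subseteq> J" "F_gen q m [^]\<^bsub>?U\<^esub> k \<in> J"
    unfolding eq by (intro U.set_add_minimal U.carrier_mult_minimal that)
qed

lemma orbit_wt_nat: "orbit_wt q \<beta> (int k) = (inverse q ^ 2) ^ k * \<beta>"
proof -
  have "q powi (- 2 * int k) = inverse (q powi (2 * int k))"
    by (simp flip: power_int_minus)
  also have "\<dots> = (inverse q ^ 2) ^ k"
    by (simp add: power_int_mult power_inverse)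
  finally show ?thesis by (simp add: orbit_wt_def)
qed

lemma orbit_xi_step:
  assumes "\<beta> \<noteq> 0"
  shows "orbit_xi q m \<alpha> \<beta> (j + 1) = orbit_xi q m \<alpha> \<beta> j + f_val q m (orbit_wt q \<beta> (j + 1))"
  using weight_module.ab_step[OF eval_weight_module[OF assms], of \<alpha> j] by simp

text \<open>
  In the first two parts the values of \<open>\<xi>\<close> along the orbit are the numbers \<open>\<tau>\<close>, with the index shifted by one.
\<close>
lemma orbit_xi_nat:
  assumes "\<beta> \<noteq> 0"
  shows "orbit_xi q m (f_val q m \<beta>) \<beta> (int k) = (\<Sum>i<Suc k. f_val q m ((inverse q ^ 2) ^ i * \<beta>))"
proof (induction k)
  case (Suc k)
  have "orbit_xi q m (f_val q m \<beta>) \<beta> (int (Suc k)) =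
      orbit_xi q m (f_val q m \<beta>) \<beta> (int k) + f_val q m (orbit_wt q \<beta> (int (Suc k)))"
    using orbit_xi_step[OF assms, of _ "int k"] by (simp add: add.commute)
  then show ?case by (simp only: Suc orbit_wt_nat sum.lessThan_Suc)
qed simp

lemma orbit_xi_neg: 
  assumes "\<beta> \<noteq> 0"
  shows "orbit_xi q m (f_val q m \<beta>) \<beta> (-1) = 0"
  using orbit_xi_step[OF assms, of "f_val q m \<beta>" "-1"] by simp

lemma shift_power:
  assumes "\<beta> \<noteq> 0"
  shows "(shift q m ^^ k) (\<alpha>, \<beta>) = (orbit_xi q m \<alpha> \<beta> (int k), orbit_wt q \<beta> (int k))"
proof (induction k)
  case (Suc k)
  have "inverse q ^ 2 * orbit_wt q \<beta> (int k) = orbit_wt q \<beta> (int k + 1)"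
    using orbit_wt_nat[of \<beta> k] orbit_wt_nat[of \<beta> "Suc k"] by (simp add: add.commute)
  then show ?case using Suc orbit_xi_step[OF assms, of \<alpha> "int k"]
    by (simp add: shift_def add.commute)
qed simp

text \<open>
  In terms of \<open>y = \<beta>\<^sup>m\<close> and \<open>Q = q\<^sup>2\<^sup>m\<close> the value is
  \<open>(1 - Q\<^sup>k\<^sup>+\<^sup>1) (y\<^sup>2 - Q\<^sup>k) / (Q\<^sup>k y (1 - Q) (q - q\<^sup>-\<^sup>1))\<close>, and \<open>1 - Q\<^sup>k\<^sup>+\<^sup>1\<close> is nonzero.
\<close>
lemma orbit_xi_eq_0_iff:
  assumes "\<beta> \<noteq> 0"
  shows "orbit_xi q m (f_val q m \<beta>) \<beta> (int k) = 0 \<longleftrightarrow> (\<beta> ^ m) ^ 2 = q ^ (2 * m * k)"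
proof -
  define Q where "Q = q ^ (2 * m)"
  define y where "y = \<beta> ^ m"
  have nz: "y \<noteq> 0" "Q \<noteq> 0" using assms q_nz by (auto simp: Q_def y_def)
  have D: "(1 - Q) * (q - inverse q) \<noteq> 0"
    using q_minus_nz one_minus_power_nz[of "2 * m"] m_pos by (simp add: Q_def)
  have QZ: "1 - Q * Q ^ k \<noteq> 0"
    using one_minus_power_nz[of "2 * m * Suc k"] m_pos by (simp add: Q_def power_add power_mult)
  have wt: "orbit_wt q \<beta> (int k) ^ m = inverse Q ^ k * y"
  proof -
    have "((inverse q ^ 2) ^ k) ^ m = inverse Q ^ k"
      by (simp add: Q_def power_inverse mult.commute mult.left_commute flip: power_mult)
    then show ?thesis by (simp add: orbit_wt_nat y_def power_mult_distrib)
  qed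
  have q2: "(q ^ 2 * \<beta>) ^ m = Q * y"
    by (simp add: Q_def y_def power_mult_distrib flip: power_mult)
  have "orbit_xi q m (f_val q m \<beta>) \<beta> (int k) =
      casimir_part q m (orbit_wt q \<beta> (int k)) - casimir_part q m (q ^ 2 * \<beta>)"
    using casimir_part_step[OF assms] by (simp add: orbit_xi_def algebra_simps)
  also have "\<dots> = ((inverse Q ^ k * y + Q * inverse (inverse Q ^ k * y)) - (Q * y + Q * inverse (Q * y)))
      / ((1 - Q) * (q - inverse q))"
    unfolding casimir_part_def power_inverse wt q2 Q_def[symmetric] by (simp add: diff_divide_distrib)
  also have "(inverse Q ^ k * y + Q * inverse (inverse Q ^ k * y)) - (Q * y + Q * inverse (Q * y)) =
      (1 - Q * Q ^ k) * (y ^ 2 - Q ^ k) / (Q ^ k * y)"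
    using nz by (simp add: power_inverse field_simps power2_eq_square)
  finally have "orbit_xi q m (f_val q m \<beta>) \<beta> (int k) =
      (1 - Q * Q ^ k) * (y ^ 2 - Q ^ k) / (Q ^ k * y) / ((1 - Q) * (q - inverse q))" .
  then have "orbit_xi q m (f_val q m \<beta>) \<beta> (int k) = 0 \<longleftrightarrow> y ^ 2 = Q ^ k"
    using nz D QZ by simp
  then show ?thesis by (simp add: y_def Q_def power_mult)
qed

lemma orbit_xi_eq_0_iff_sign:
  assumes "\<beta> \<noteq> 0"
  shows "orbit_xi q m (f_val q m \<beta>) \<beta> (int k) = 0 \<longleftrightarrow>
    \<beta> ^ m = q ^ (m * k) \<or> \<beta> ^ m = - (q ^ (m * k))"
proof -
  have "q ^ (2 * m * k) = (q ^ (m * k)) ^ 2"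
    by (simp add: ac_simps flip: power_mult)
  then show ?thesis by (simp add: orbit_xi_eq_0_iff[OF assms] power2_eq_iff)
qed

lemma orbit_xi_zero_unique:
  assumes "\<beta> \<noteq> 0" and "orbit_xi q m (f_val q m \<beta>) \<beta> (int n) = 0"
    and "orbit_xi q m (f_val q m \<beta>) \<beta> (int k) = 0"
  shows "n = k"
proof (rule ccontr)
  have eq: "q ^ (2 * m * i) = q ^ (2 * m * j) \<Longrightarrow> i < j \<Longrightarrow> False" for i j
  proof -
    assume "q ^ (2 * m * i) = q ^ (2 * m * j)" and ij: "i < j"
    moreover have "2 * m * j = 2 * m * i + 2 * m * (j - i)"
      using ij by (simp add: distrib_left[symmetric])
    ultimately have "q ^ (2 * m * (j - i)) = 1" using q_nz by (simp add: power_add)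
    then show False using not_root[of "2 * m * (j - i)"] m_pos ij by simp
  qed
  assume "n \<noteq> k"
  then show False
    using assms(2,3) eq[of n k] eq[of k n] orbit_xi_eq_0_iff[OF assms(1)] by (metis linorder_neqE_nat)
qed

lemma highest_weight_quotient:
  assumes \<beta>: "\<beta> \<noteq> 0" and L: "left_ideal L (U_alg q m)"
    and gens: "M_ideal q m (f_val q m \<beta>) \<beta> \<subseteq> L" "E_gen q m \<in> L"
    and one: "\<one>\<^bsub>U_alg q m\<^esub> \<notin> L"
    and cut: "\<And>k. orbit_xi q m (f_val q m \<beta>) \<beta> (int k) = 0 \<Longrightarrow> U_class q m (lF ^ Suc k) \<in> L"
  shows "cyclic_quotient q m L GenF GenE (inverse q ^ 2) \<beta> 1"
proof (intro cyclic_quotient.intro cyclic_quotient_axioms.intro generic_q_axioms L \<beta>)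
  show "inverse q ^ 2 \<noteq> 0" using q_nz by simp
  show "U_class q m (lK - free_scalar \<beta>) \<in> L" using M_ideal_facts(2) gens by blast
  show "U_class q m (letter GenF ^ Suc k) \<in> L"
    if "1 * (\<Sum>i<Suc k. f_val q m ((inverse q ^ 2) ^ i * \<beta>)) = 0" for k
    using that cut[of k] by (simp only: orbit_xi_nat[OF \<beta>] mult_1)
  show "U_class q m (letter GenE) \<in> L" using gens by (simp add: E_gen_def)
  show "U_class q m 1 \<notin> L" using one by (simp add: U_class_one)
qed (use U_ideal_relations in auto)

lemma lowest_weight_quotient:
  assumes \<beta>: "\<beta> \<noteq> 0" and L: "left_ideal L (U_alg q m)"
    and gens: "M_ideal q m 0 \<beta> \<subseteq> L" "F_gen q m \<in> L"
    and one: "\<one>\<^bsub>U_alg q m\<^esub> \<notin> L"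
    and nz: "\<And>k. (\<Sum>i<Suc k. f_val q m ((q ^ 2) ^ i * \<beta>)) \<noteq> 0"
  shows "cyclic_quotient q m L GenE GenF (q ^ 2) \<beta> (-1)"
proof (intro cyclic_quotient.intro cyclic_quotient_axioms.intro generic_q_axioms L \<beta>)
  show "q ^ 2 \<noteq> 0" using q_nz by simp
  show "U_class q m (lK - free_scalar \<beta>) \<in> L" using M_ideal_facts(2) gens by blast
  have "letter GenF * letter GenE - letter GenE * letter GenF
      - free_scalar (- 1 / (q - inverse q)) * (lK ^ m - lK' ^ m) =
      - 1 * (letter GenE * letter GenF - letter GenF * letter GenE
      - free_scalar (1 / (q - inverse q)) * (lK ^ m - lK' ^ m))"
    by (simp add: free_scalar_minus algebra_simps flip: minus_divide_left)
  then show "letter GenF * letter GenE - letter GenE * letter GenF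
      - free_scalar (- 1 / (q - inverse q)) * (lK ^ m - lK' ^ m) \<in> U_ideal q m"
    using U_ideal_mult_left[OF U_ideal_relations(5)] by metis
  show "U_class q m (letter GenE ^ Suc k) \<in> L"
    if "- 1 * (\<Sum>i<Suc k. f_val q m ((q ^ 2) ^ i * \<beta>)) = 0" for k
    using that nz[of k] by (simp del: sum.lessThan_Suc)
  show "U_class q m (letter GenF) \<in> L" using gens by (simp add: F_gen_def)
  show "U_class q m 1 \<notin> L" using one by (simp add: U_class_one)
qed (use U_ideal_relations in auto)

lemma orbit_weight_module_E:
  "\<beta> \<noteq> 0 \<Longrightarrow> weight_module q m (orbit_wt q \<beta>) (orbit_xi q m \<alpha> \<beta>) (\<lambda>_. 1)"
  by (rule orbit_weight_module) simp_all

text \<open>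
  With \<open>\<xi>\<close> attached to \<open>E\<close>, the delta function at \<open>0\<close> is annihilated by \<open>E\<close>: the only value that could
  survive is the one at \<open>-1\<close>, and there \<open>\<xi>\<close> takes the value \<open>\<alpha> - f(\<beta>) = 0\<close>.
\<close>
lemma one_notin_P_1_inf:
  assumes \<beta>: "\<beta> \<noteq> 0"
  shows "\<one>\<^bsub>U_alg q m\<^esub> \<notin> P_1_inf q m (M_ideal q m (f_val q m \<beta>) \<beta>)"
proof
  let ?P = "M_ideal q m (f_val q m \<beta>) \<beta>"
  interpret W: weight_module q m "orbit_wt q \<beta>" "orbit_xi q m (f_val q m \<beta>) \<beta>" "\<lambda>_. 1"
    by (rule orbit_weight_module_E[OF \<beta>])
  let ?J = "{u \<in> carrier (U_alg q m). W.uact u (delta 0) \<in> {\<lambda>_. 0}}"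
  assume one: "\<one>\<^bsub>U_alg q m\<^esub> \<in> P_1_inf q m ?P"
  have "left_ideal ?J (U_alg q m)"
  proof (rule W.left_ideal_stable_subspace)
    show "letter_op (orbit_wt q \<beta>) (orbit_xi q m (f_val q m \<beta>) \<beta>) (\<lambda>_. 1) x g \<in> {\<lambda>_. 0}"
      if "g \<in> {\<lambda>_. 0}" for x g
      using that by (cases x) auto
  qed auto
  moreover have "?P \<subseteq> ?J"
    using W.M_ideal_kills_delta M_ideal_facts(1) by auto
  moreover have "W.uact (E_gen q m) (delta 0) j = 0" for j
    using orbit_xi_neg[OF \<beta>] by (cases "j = -1") (auto simp: delta_def)
  then have "E_gen q m \<in> ?J" by auto
  ultimately have "P_1_inf q m ?P \<subseteq> ?J" by (rule P_1_inf_left_ideal)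
  then have "W.uact \<one>\<^bsub>U_alg q m\<^esub> (delta 0) 0 = 0" using one by (auto dest: fun_cong)
  then show False by (simp add: W.uact_one delta_def)
qed

text \<open>
  \<open>F\<close> moves the delta function to the right. As \<open>\<xi>\<close> vanishes at the index \<open>n\<close>, \<open>E\<close> cannot bring
  anything back from the indices beyond \<open>n\<close>, so the functions that vanish up to \<open>n\<close> form a submodule. It
  contains the image of the delta function under \<open>F\<^sup>n\<^sup>+\<^sup>1\<close>, but not the delta function at \<open>0\<close>.
\<close>
lemma one_notin_P_1_fin:
  assumes \<beta>: "\<beta> \<noteq> 0" and n: "orbit_xi q m (f_val q m \<beta>) \<beta> (int n) = 0"
  shows "\<one>\<^bsub>U_alg q m\<^esub> \<notin> P_1_fin q m (M_ideal q m (f_val q m \<beta>) \<beta>) (Suc n)"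
proof
  let ?P = "M_ideal q m (f_val q m \<beta>) \<beta>"
  interpret W: weight_module q m "orbit_wt q \<beta>" "orbit_xi q m (f_val q m \<beta>) \<beta>" "\<lambda>_. 1"
    by (rule orbit_weight_module_E[OF \<beta>])
  let ?S = "{g :: int \<Rightarrow> complex. \<forall>j\<le>int n. g j = 0}"
  let ?J = "{u \<in> carrier (U_alg q m). W.uact u (delta 0) \<in> ?S}"
  assume one: "\<one>\<^bsub>U_alg q m\<^esub> \<in> P_1_fin q m ?P (Suc n)"
  have J: "left_ideal ?J (U_alg q m)"
  proof (rule W.left_ideal_stable_subspace)
    show "letter_op (orbit_wt q \<beta>) (orbit_xi q m (f_val q m \<beta>) \<beta>) (\<lambda>_. 1) x g \<in> ?S"
      if g: "g \<in> ?S" for x g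
    proof (cases x)
      case GenE
      have "orbit_xi q m (f_val q m \<beta>) \<beta> j * g (j + 1) = 0" if "j \<le> int n" for j
        using that g n by (cases "j = int n") auto
      then show ?thesis using GenE by simp
    qed (use g in auto)
  qed auto
  have "?P \<subseteq> ?J"
    using W.M_ideal_kills_delta M_ideal_facts(1) by auto
  moreover have "W.uact (E_gen q m) (delta 0) j = 0" for j
    using orbit_xi_neg[OF \<beta>] by (cases "j = -1") (auto simp: delta_def)
  then have "E_gen q m \<in> ?J" by auto
  ultimately have "P_1_inf q m ?P \<subseteq> ?J" using J by (intro P_1_inf_left_ideal)
  moreover have "F_gen q m [^]\<^bsub>U_alg q m\<^esub> Suc n \<in> ?J"
  proof -
    have "W.act (lF ^ k) (delta 0) = delta (int k)" for k
      by (induction k) (auto simp: act_mult act_letter delta_def)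
    then have "W.uact (U_class q m (lF ^ Suc n)) (delta 0) \<in> ?S"
      by (simp only: W.uact_class) (simp add: delta_def)
    then show ?thesis by (simp only: F_gen_def U_class_power) (simp del: power_Suc W.uact_class)
  qed
  ultimately have "P_1_fin q m ?P (Suc n) \<subseteq> ?J" using J by (intro P_1_fin_left_ideal)
  then have "W.uact \<one>\<^bsub>U_alg q m\<^esub> (delta 0) 0 = 0" using one by auto
  then show False by (simp add: W.uact_one delta_def)
qed

text \<open>
  With \<open>\<xi>\<close> attached to \<open>F\<close>, the delta function at \<open>0\<close> is annihilated by \<open>F\<close>, because \<open>\<xi>\<close> takes the value
  \<open>\<alpha> = 0\<close> there.
\<close>
lemma one_notin_P_inf_1:
  assumes \<beta>: "\<beta> \<noteq> 0"
  shows "\<one>\<^bsub>U_alg q m\<^esub> \<notin> P_inf_1 q m (M_ideal q m 0 \<beta>)"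
proof
  let ?P = "M_ideal q m 0 \<beta>"
  interpret W: weight_module q m "orbit_wt q \<beta>" "\<lambda>_. 1" "orbit_xi q m 0 \<beta>"
    by (rule eval_weight_module[OF \<beta>])
  let ?J = "{u \<in> carrier (U_alg q m). W.uact u (delta 0) \<in> {\<lambda>_. 0}}"
  assume one: "\<one>\<^bsub>U_alg q m\<^esub> \<in> P_inf_1 q m ?P"
  have "left_ideal ?J (U_alg q m)"
  proof (rule W.left_ideal_stable_subspace)
    show "letter_op (orbit_wt q \<beta>) (\<lambda>_. 1) (orbit_xi q m 0 \<beta>) x g \<in> {\<lambda>_. 0}"
      if "g \<in> {\<lambda>_. 0}" for x g
      using that by (cases x) auto
  qed auto
  moreover have "?P \<subseteq> ?J"
    using W.M_ideal_kills_delta M_ideal_facts(1) by auto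
  moreover have "F_gen q m \<in> ?J"
    by (auto simp: fun_eq_iff delta_def)
  ultimately have "P_inf_1 q m ?P \<subseteq> ?J" by (rule P_inf_1_left_ideal)
  then have "W.uact \<one>\<^bsub>U_alg q m\<^esub> (delta 0) 0 = 0" using one by (auto dest: fun_cong)
  then show False by (simp add: W.uact_one delta_def)
qed

lemma theta_power_xi_in_M_ideal:
  assumes "\<beta> \<noteq> 0" "orbit_xi q m \<alpha> \<beta> (int n) = 0"
  shows "(theta q m ^^ n) (xi q m) \<in> M_ideal q m \<alpha> \<beta>"
proof (rule vanishing_in_M_ideal)
  have "(\<alpha>, \<beta>) \<in> points" "(orbit_xi q m \<alpha> \<beta> (int n), orbit_wt q \<beta> (int n)) \<in> points"
    using assms(1) q_nz by (auto simp: orbit_wt_nat)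
  then show "ev (\<alpha>, \<beta>) ((theta q m ^^ n) (xi q m)) = 0" "(theta q m ^^ n) (xi q m) \<in> Rset"
    using eval_theta_power[of "xi q m" "(\<alpha>, \<beta>)" n] assms by (simp_all add: shift_power)
qed fact

lemma theta_inv_xi_in_M_ideal:
  assumes "\<beta> \<noteq> 0"
  shows "theta_inv q m (xi q m) \<in> M_ideal q m (f_val q m \<beta>) \<beta>"
proof (rule vanishing_in_M_ideal)
  have "shift_inv q m (f_val q m \<beta>, \<beta>) \<in> points" using assms by simp
  then show "ev (f_val q m \<beta>, \<beta>) (theta_inv q m (xi q m)) = 0" "theta_inv q m (xi q m) \<in> Rset"
    using eval_theta_inv[of "xi q m" "(f_val q m \<beta>, \<beta>)"] assms by (simp_all add: shift_inv_def)
qed fact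

lemma sum_f_val_geometric:
  "(\<Sum>i<n. f_val q m ((q ^ 2) ^ i * \<beta>)) =
    1 / (q - inverse q) *
      ((1 - q powi (2 * int n * int m)) / (1 - q powi (2 * int m)) * \<beta> powi (int m)
       - (1 - q powi (- 2 * int n * int m)) / (1 - q powi (- 2 * int m)) * \<beta> powi (- int m))"
proof -
  define Q where "Q = q ^ (2 * m)"
  have Q: "Q \<noteq> 1" "inverse Q \<noteq> 1" "Q \<noteq> 0"
    using not_root[of "2 * m"] m_pos q_nz by (auto simp: Q_def)
  have Qn: "Q ^ n = q powi (2 * int n * int m)"
  proof -
    have "Q ^ n = q powi int (2 * m * n)"
      by (simp only: Q_def power_mult power_int_of_nat)
    then show ?thesis by (simp add: ac_simps)
  qed
  have pow: "((q ^ 2) ^ i * \<beta>) ^ m = Q ^ i * \<beta> ^ m" for i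
    by (simp add: Q_def power_mult_distrib mult.commute mult.left_commute flip: power_mult)
  have "(\<Sum>i<n. f_val q m ((q ^ 2) ^ i * \<beta>)) =
      (\<Sum>i<n. 1 / (q - inverse q) * (Q ^ i * \<beta> ^ m - inverse Q ^ i * inverse (\<beta> ^ m)))"
    unfolding f_val_def power_inverse pow by (simp add: power_inverse)
  also have "\<dots> = 1 / (q - inverse q) *
      ((\<Sum>i<n. Q ^ i) * \<beta> ^ m - (\<Sum>i<n. inverse Q ^ i) * inverse (\<beta> ^ m))"
    by (simp only: sum_distrib_right sum_subtractf flip: sum_distrib_left)
  also have "(\<Sum>i<n. Q ^ i) = (1 - Q ^ n) / (1 - Q)"
    using Q by (simp add: sum_gp_strict)
  also have "(\<Sum>i<n. inverse Q ^ i) = (1 - inverse Q ^ n) / (1 - inverse Q)"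
    using Q(2) by (simp only: sum_gp_strict if_False)
  also have "inverse Q ^ n = q powi (- 2 * int n * int m)"
    using power_int_minus[of q "2 * int n * int m"] by (simp add: Qn power_inverse)
  also have "Q ^ n = q powi (2 * int n * int m)" by (rule Qn)
  also have "Q = q powi (2 * int m)"
    by (simp add: Q_def flip: power_int_of_nat)
  also have "inverse (q powi (2 * int m)) = q powi (- 2 * int m)"
    by (simp add: power_int_minus)
  finally show ?thesis by (simp add: power_int_minus)
qed

end

theorem theorem2p3:
  fixes q \<alpha> \<beta> :: complex and m :: nat
  assumes "q \<noteq> 0"
    and "\<And>k::nat. k \<ge> 1 \<Longrightarrow> q ^ k \<noteq> 1"
    and "m \<ge> 1"
    and "\<beta> \<noteq> 0"
  shows
    "(\<forall>n::nat.
        \<alpha> = (\<beta> ^ m - \<beta> powi (- int m)) / (q - inverse q) \<and>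
        (\<beta> ^ m = q ^ (m * n) \<or> \<beta> ^ m = - (q ^ (m * n))) \<longrightarrow>
          (theta q m ^^ n) (xi q m) \<in> M_ideal q m \<alpha> \<beta> \<and>
          theta_inv q m (xi q m) \<in> M_ideal q m \<alpha> \<beta> \<and>
          irreducible_module (U_alg q m)
            (quot_module (U_alg q m) (P_1_fin q m (M_ideal q m \<alpha> \<beta>) (n + 1))) \<and>
          finite_dim_module (U_scalar q m)
            (quot_module (U_alg q m) (P_1_fin q m (M_ideal q m \<alpha> \<beta>) (n + 1))))
     \<and>
     (\<alpha> = (\<beta> ^ m - \<beta> powi (- int m)) / (q - inverse q) \<and>
      (\<forall>n::nat. \<beta> ^ m \<noteq> q ^ (m * n) \<and> \<beta> ^ m \<noteq> - (q ^ (m * n))) \<longrightarrow>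
        irreducible_module (U_alg q m)
          (quot_module (U_alg q m) (P_1_inf q m (M_ideal q m \<alpha> \<beta>))) \<and>
        \<not> finite_dim_module (U_scalar q m)
          (quot_module (U_alg q m) (P_1_inf q m (M_ideal q m \<alpha> \<beta>))))
     \<and>
     (\<alpha> = 0 \<and>
      (\<forall>n::nat. n \<ge> 1 \<longrightarrow>
        1 / (q - inverse q) *
          ((1 - q powi (2 * int n * int m)) / (1 - q powi (2 * int m)) * \<beta> powi (int m)
           - (1 - q powi (- 2 * int n * int m)) / (1 - q powi (- 2 * int m)) * \<beta> powi (- int m))
        \<noteq> 0) \<longrightarrow>
        irreducible_module (U_alg q m)
          (quot_module (U_alg q m) (P_inf_1 q m (M_ideal q m \<alpha> \<beta>))) \<and>
        \<not> finite_dim_module (U_scalar q m)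
          (quot_module (U_alg q m) (P_inf_1 q m (M_ideal q m \<alpha> \<beta>))))"
proof -
  interpret generic_q q m
    using assms by unfold_locales auto
  have f: "(\<beta> ^ m - \<beta> powi (- int m)) / (q - inverse q) = f_val q m \<beta>"
    by (simp add: f_val_def power_int_minus power_inverse)
  note \<beta> = assms(4)
  show ?thesis
    unfolding f
  proof (intro conjI allI impI; elim conjE)
    fix n
    assume \<alpha>: "\<alpha> = f_val q m \<beta>" and "\<beta> ^ m = q ^ (m * n) \<or> \<beta> ^ m = - (q ^ (m * n))"
    then have n: "orbit_xi q m (f_val q m \<beta>) \<beta> (int n) = 0"
      by (simp add: orbit_xi_eq_0_iff_sign[OF \<beta>])
    show "(theta q m ^^ n) (xi q m) \<in> M_ideal q m \<alpha> \<beta>"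
      unfolding \<alpha> by (rule theta_power_xi_in_M_ideal[OF \<beta> n])
    show "theta_inv q m (xi q m) \<in> M_ideal q m \<alpha> \<beta>"
      unfolding \<alpha> by (rule theta_inv_xi_in_M_ideal[OF \<beta>])
    let ?L = "P_1_fin q m (M_ideal q m (f_val q m \<beta>) \<beta>) (Suc n)"
    have F: "U_class q m (lF ^ Suc n) \<in> ?L"
      using P_1_fin_left_ideal(3)[where k = "Suc n"] by (simp only: F_gen_def U_class_power)
    interpret C: cyclic_quotient q m ?L GenF GenE "inverse q ^ 2" \<beta> 1
    proof (rule highest_weight_quotient[OF \<beta> P_1_fin_left_ideal(1)])
      show "U_class q m (lF ^ Suc k) \<in> ?L" if "orbit_xi q m (f_val q m \<beta>) \<beta> (int k) = 0" for k
        using orbit_xi_zero_unique[OF \<beta> n that] F by simp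
    qed (rule order_trans[OF P_1_inf_left_ideal(2) P_1_fin_left_ideal(2)]
        subsetD[OF P_1_fin_left_ideal(2) P_1_inf_left_ideal(3)] one_notin_P_1_fin[OF \<beta> n])+
    show "irreducible_module (U_alg q m)
        (quot_module (U_alg q m) (P_1_fin q m (M_ideal q m \<alpha> \<beta>) (n + 1)))"
      using C.irreducible by (simp add: \<alpha>)
    show "finite_dim_module (U_scalar q m)
        (quot_module (U_alg q m) (P_1_fin q m (M_ideal q m \<alpha> \<beta>) (n + 1)))"
      using C.finite_dim[OF F] by (simp add: \<alpha>)
  next
    assume \<alpha>: "\<alpha> = f_val q m \<beta>"
      and "\<forall>n. \<beta> ^ m \<noteq> q ^ (m * n) \<and> \<beta> ^ m \<noteq> - (q ^ (m * n))"
    then have nz: "orbit_xi q m (f_val q m \<beta>) \<beta> (int k) \<noteq> 0" for k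
      by (simp add: orbit_xi_eq_0_iff_sign[OF \<beta>])
    let ?L = "P_1_inf q m (M_ideal q m (f_val q m \<beta>) \<beta>)"
    interpret C: cyclic_quotient q m ?L GenF GenE "inverse q ^ 2" \<beta> 1
      by (rule highest_weight_quotient[OF \<beta> P_1_inf_left_ideal(1-3) one_notin_P_1_inf[OF \<beta>]])
        (use nz in blast)
    show "irreducible_module (U_alg q m) (quot_module (U_alg q m) (P_1_inf q m (M_ideal q m \<alpha> \<beta>)))"
      using C.irreducible by (simp add: \<alpha>)
    have "C.\<tau> (Suc k) \<noteq> 0" for k
      using nz[of k] unfolding C.\<tau>_def mult_1 orbit_xi_nat[OF \<beta>] .
    then show "\<not> finite_dim_module (U_scalar q m)
        (quot_module (U_alg q m) (P_1_inf q m (M_ideal q m \<alpha> \<beta>)))"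
      unfolding \<alpha> by (rule C.infinite_dim)
  next
    assume \<alpha>: "\<alpha> = 0" and nz: "\<forall>n\<ge>1. 1 / (q - inverse q) *
          ((1 - q powi (2 * int n * int m)) / (1 - q powi (2 * int m)) * \<beta> powi (int m)
           - (1 - q powi (- 2 * int n * int m)) / (1 - q powi (- 2 * int m)) * \<beta> powi (- int m)) \<noteq> 0"
    have nz: "(\<Sum>i<Suc k. f_val q m ((q ^ 2) ^ i * \<beta>)) \<noteq> 0" for k
      unfolding sum_f_val_geometric by (rule nz[rule_format]) simp
    let ?L = "P_inf_1 q m (M_ideal q m 0 \<beta>)"
    interpret C: cyclic_quotient q m ?L GenE GenF "q ^ 2" \<beta> "-1"
      by (rule lowest_weight_quotient[OF \<beta> P_inf_1_left_ideal(1-3) one_notin_P_inf_1[OF \<beta>] nz])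
    show "irreducible_module (U_alg q m) (quot_module (U_alg q m) (P_inf_1 q m (M_ideal q m \<alpha> \<beta>)))"
      using C.irreducible by (simp add: \<alpha>)
    have "C.\<tau> (Suc k) \<noteq> 0" for k
      using nz[of k] by (simp add: C.\<tau>_def del: sum.lessThan_Suc)
    then show "\<not> finite_dim_module (U_scalar q m)
        (quot_module (U_alg q m) (P_inf_1 q m (M_ideal q m \<alpha> \<beta>)))"
      unfolding \<alpha> by (rule C.infinite_dim)
  qed
qed

end
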